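(* Let $H$ be a graph with a critical edge and $\chi(H)=k+1\ge 3$, and suppose that $H$ is a subgraph of $M_k(a,a,1)$ for some positive integer $a$. Let $f:\mathbb{N}\to\mathbb{R}_{\ge 0}$ be a function with $f(n)=o(n^2)$. Then there is a constant $C$ (depending on $H$ and $f$) such that for all sufficiently large $n$ the following holds: if $G$ is an $H$-free graph on $n$ vertices with $e(G)\ge t_k(n)-f(n)$, then $G$ can be made $k$-partite by deleting at most $C\, n^{-2} f(n)^{2}$ edges.
   Context: An edge $e$ of a graph $H$ is critical if $\chi(H-e)=\chi(H)-1$. $t_k(n)$ is the number of edges of the complete $k$-partite graph on $n$ vertices with class sizes as equal as possible. For disjoint vertex sets $A,B$, $K[A,B]=\{ab: a\in A, b\in B\}$. The blown-up Mycielskian graph $M_k(a,b,c)$: let $V_1,\dots,V_k$ be sets of size $a$, $W_1,\dots,W_k$ sets of size $b$, and $U$ a set of size $c$, all pairwise disjoint; $M_k(a,b,c)$ has vertex set $\bigcup_i V_i\cup\bigcup_i W_i\cup U$ and edge set $\bigcup_{i\ne j}K[V_i,V_j]\cup\bigcup_{i\ne j}K[V_i,W_j]\cup\bigcup_i K[W_i,U]$. A graph is $k$-partite if its vertex set can be partitioned into $k$ classes with no edge inside a class. *)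

theory Defs
  imports Complex_Main "HOL-Library.Landau_Symbols" "HOL-Library.Disjoint_Sets"
begin

datatype 'a graph = Graph (verts: "'a set") (edges: "'a set set")

definition simple_graph :: "'a graph \<Rightarrow> bool" where
  "simple_graph G \<longleftrightarrow>
     finite (verts G) \<and> (\<forall>e\<in>edges G. e \<subseteq> verts G \<and> card e = 2)"

definition delete_edges :: "'a graph \<Rightarrow> 'a set set \<Rightarrow> 'a graph" where
  "delete_edges G F = Graph (verts G) (edges G - F)"

definition proper_colouring :: "'a graph \<Rightarrow> nat \<Rightarrow> ('a \<Rightarrow> nat) \<Rightarrow> bool" where
  "proper_colouring G k c \<longleftrightarrow>
     c ` verts G \<subseteq> {..<k} \<and> (\<forall>u v. {u, v} \<in> edges G \<longrightarrow> c u \<noteq> c v)"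

definition chromatic_number :: "'a graph \<Rightarrow> nat" where
  "chromatic_number G = (LEAST k. \<exists>c. proper_colouring G k c)"

text \<open>Written with \<open>+ 1\<close> on the left so that no truncated subtraction occurs.\<close>

definition critical_edge :: "'a graph \<Rightarrow> 'a set \<Rightarrow> bool" where
  "critical_edge H e \<longleftrightarrow>
     e \<in> edges H \<and> chromatic_number (delete_edges H {e}) + 1 = chromatic_number H"

text \<open>The classes are allowed to be empty.\<close>

definition k_partite :: "nat \<Rightarrow> 'a graph \<Rightarrow> bool" where
  "k_partite k G \<longleftrightarrow>
     (\<exists>P :: nat \<Rightarrow> 'a set.
        (\<Union>i<k. P i) = verts G \<and> disjoint_family_on P {..<k} \<and>
        (\<forall>i<k. \<forall>e\<in>edges G. \<not> e \<subseteq> P i))"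

text \<open>Subgraphs are taken up to isomorphism and need not be induced.\<close>

definition is_subgraph :: "'a graph \<Rightarrow> 'b graph \<Rightarrow> bool" where
  "is_subgraph H G \<longleftrightarrow>
     (\<exists>\<phi>. inj_on \<phi> (verts H) \<and> \<phi> ` verts H \<subseteq> verts G \<and>
          (\<forall>e\<in>edges H. \<phi> ` e \<in> edges G))"

definition free_of :: "'a graph \<Rightarrow> 'b graph \<Rightarrow> bool" where
  "free_of H G \<longleftrightarrow> \<not> is_subgraph H G"

text \<open>The classes are the residue classes modulo \<open>k\<close> in \<open>{..<n}\<close>, whose sizes pairwise
  differ by at most one.\<close>

definition turan_graph :: "nat \<Rightarrow> nat \<Rightarrow> nat graph" where
  "turan_graph k n =
     Graph {..<n} {{u, v} | u v. u < n \<and> v < n \<and> u mod k \<noteq> v mod k}"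

definition turan_number :: "nat \<Rightarrow> nat \<Rightarrow> nat" where
  "turan_number k n = card (edges (turan_graph k n))"

definition complete_between :: "'a set \<Rightarrow> 'a set \<Rightarrow> 'a set set" where
  "complete_between A B = {{x, y} | x y. x \<in> A \<and> y \<in> B}"

text \<open>\<open>MV i j\<close> and \<open>MW i j\<close> are the \<open>j\<close>-th vertices of the classes \<open>V\<^sub>i\<close> and \<open>W\<^sub>i\<close>,
  where \<open>i\<close> runs through \<open>0, \<dots>, k - 1\<close>.\<close>

datatype mycielskian_vertex = MV nat nat | MW nat nat | MU nat

definition blown_up_mycielskian ::
  "nat \<Rightarrow> nat \<Rightarrow> nat \<Rightarrow> nat \<Rightarrow> mycielskian_vertex graph" where
  "blown_up_mycielskian k a b c =
     (let V = (\<lambda>i. MV i ` {..<a}); W = (\<lambda>i. MW i ` {..<b}); U = MU ` {..<c} in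
      Graph ((\<Union>i<k. V i) \<union> (\<Union>i<k. W i) \<union> U)
        ((\<Union>i<k. \<Union>j\<in>{..<k} - {i}. complete_between (V i) (V j)) \<union>
         (\<Union>i<k. \<Union>j\<in>{..<k} - {i}. complete_between (V i) (W j)) \<union>
         (\<Union>i<k. complete_between (W i) U)))"

end

theory Submission
  imports Defs "HOL-Combinatorics.Transposition"
begin

text \<open>
  Stability. A vertex set \<open>S\<close> maximising \<open>2 e(S) - \<beta> |S| (|S| + 1)\<close> induces a graph of minimum degree at
  least \<open>\<beta> |S|\<close>, which contains a large complete \<open>k\<close>-partite graph with classes \<open>D\<^sub>0, \<dots>, D\<^bsub>k-1\<^esub>\<close>. Since
  \<open>H\<close> embeds into a complete \<open>k\<close>-partite graph with one edge added inside a class, every vertex has few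
  neighbours in some \<open>D\<^sub>i\<close>; counting degrees, almost all vertices are joined to most of all the other
  classes, and two such vertices with the same \<open>i\<close> are not adjacent. So \<open>G\<close> is close to \<open>k\<close>-partite.

  Refinement. Take a \<open>k\<close>-partition with the fewest inner edges, and let \<open>B\<close> be the set of the vertices that
  miss more than \<open>\<gamma> n\<close> vertices of other classes. Vertices outside \<open>B\<close> can be extended greedily
  to complete \<open>k\<close>-partite graphs. Hence every inner edge meets \<open>B\<close>. A vertex with more than \<open>|B| + t\<close>
  neighbours in its own class has as many in every class, by the choice of the partition, and would be
  the apex of an \<open>M\<^sub>k(t, t, 1)\<close>. So there are at most \<open>|B| (|B| + t)\<close> inner edges, while the edge count
  forces \<open>\<gamma> n |B| = O(f(n))\<close>.
\<close>

section \<open>Finite simple graphs\<close>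

lemma complete_between_subset_iff:
  "complete_between A B \<subseteq> F \<longleftrightarrow> (\<forall>x\<in>A. \<forall>y\<in>B. {x, y} \<in> F)"
  by (auto simp: complete_between_def)

lemma complete_between_commute: "complete_between A B = complete_between B A"
  by (auto simp: complete_between_def insert_commute)

lemma verts_delete_edges [simp]: "verts (delete_edges G F) = verts G"
  and edges_delete_edges [simp]: "edges (delete_edges G F) = edges G - F"
  by (simp_all add: delete_edges_def)

lemma simple_graph_delete_edges: "simple_graph G \<Longrightarrow> simple_graph (delete_edges G F)"
  by (simp add: simple_graph_def)

definition induced_subgraph :: "'a graph \<Rightarrow> 'a set \<Rightarrow> 'a graph" where
  "induced_subgraph G S = Graph S {e \<in> edges G. e \<subseteq> S}"

lemma verts_induced_subgraph [simp]: "verts (induced_subgraph G S) = S"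
  and edges_induced_subgraph [simp]: "edges (induced_subgraph G S) = {e \<in> edges G. e \<subseteq> S}"
  by (simp_all add: induced_subgraph_def)

lemma simple_graph_induced_subgraph:
  "simple_graph G \<Longrightarrow> S \<subseteq> verts G \<Longrightarrow> simple_graph (induced_subgraph G S)"
  by (auto simp: simple_graph_def intro: finite_subset)

lemma is_subgraph_trans:
  assumes "is_subgraph F G" "is_subgraph G H"
  shows "is_subgraph F H"
proof -
  obtain f where f: "inj_on f (verts F)" "f ` verts F \<subseteq> verts G" "\<forall>e\<in>edges F. f ` e \<in> edges G"
    using assms(1) unfolding is_subgraph_def by (elim exE conjE)
  obtain g where g: "inj_on g (verts G)" "g ` verts G \<subseteq> verts H" "\<forall>e\<in>edges G. g ` e \<in> edges H"
    using assms(2) unfolding is_subgraph_def by (elim exE conjE)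
  have "inj_on (g \<circ> f) (verts F)" using f g by (meson comp_inj_on inj_on_subset)
  moreover have "(g \<circ> f) ` verts F \<subseteq> verts H" using f(2) g(2) by auto
  moreover have "\<forall>e\<in>edges F. (g \<circ> f) ` e \<in> edges H" using f(3) g(3) by (metis image_comp)
  ultimately show ?thesis unfolding is_subgraph_def by blast
qed

lemma free_of_induced_subgraph:
  assumes "free_of H G" "S \<subseteq> verts G"
  shows "free_of H (induced_subgraph G S)"
proof -
  have "is_subgraph (induced_subgraph G S) G"
    unfolding is_subgraph_def using assms(2) by (intro exI[of _ id]) auto
  then show ?thesis
    using assms(1) is_subgraph_trans unfolding free_of_def by blast
qed

definition neighbours :: "'a graph \<Rightarrow> 'a \<Rightarrow> 'a set" where
  "neighbours G v = {w. {v, w} \<in> edges G}"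

definition degree :: "'a graph \<Rightarrow> 'a \<Rightarrow> nat" where
  "degree G v = card (neighbours G v)"

definition min_degree_at_least :: "'a graph \<Rightarrow> real \<Rightarrow> bool" where
  "min_degree_at_least G x \<longleftrightarrow> (\<forall>v\<in>verts G. x \<le> degree G v)"

lemma mem_neighbours_iff [simp]: "w \<in> neighbours G v \<longleftrightarrow> {v, w} \<in> edges G"
  by (simp add: neighbours_def)

context
  fixes G :: "'a graph"
  assumes G: "simple_graph G"
begin

lemma finite_verts: "finite (verts G)"
  using G by (simp add: simple_graph_def)

lemma edge_vertsD: "{u, v} \<in> edges G \<Longrightarrow> u \<in> verts G \<and> v \<in> verts G \<and> u \<noteq> v"
  using G by (force simp: simple_graph_def)

lemma edgeE:
  assumes "e \<in> edges G"
  obtains u v where "e = {u, v}" "u \<noteq> v" "u \<in> verts G" "v \<in> verts G"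
  using G assms unfolding simple_graph_def by (metis card_2_iff insert_subset)

lemma finite_edges: "finite (edges G)"
  using G unfolding simple_graph_def by (meson Pow_iff finite_Pow_iff finite_subset subsetI)

lemma disjoint_if_complete_between:
  "complete_between A B \<subseteq> edges G \<Longrightarrow> A \<inter> B = {}"
  using edge_vertsD unfolding complete_between_subset_iff by blast

lemma neighbours_subset: "neighbours G v \<subseteq> verts G"
  using edge_vertsD by (auto simp: neighbours_def)

lemma finite_neighbours: "finite (neighbours G v)"
  using neighbours_subset finite_verts by (rule finite_subset)

lemma degree_le_card_verts: "degree G v \<le> card (verts G)"
  unfolding degree_def using finite_verts neighbours_subset by (rule card_mono)

lemma card_incident_edges: "card {e \<in> edges G. v \<in> e} = degree G v"
proof -
  have "{e \<in> edges G. v \<in> e} = (\<lambda>w. {v, w}) ` neighbours G v"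
  proof (intro equalityI subsetI)
    fix e assume incident: "e \<in> {e \<in> edges G. v \<in> e}"
    then obtain w where "e = {v, w}" by (auto elim: edgeE)
    then show "e \<in> (\<lambda>w. {v, w}) ` neighbours G v" using incident by auto
  qed auto
  moreover have "inj_on (\<lambda>w. {v, w}) (neighbours G v)"
    by (auto intro!: inj_onI simp: doubleton_eq_iff)
  ultimately show ?thesis
    by (simp add: degree_def card_image)
qed

lemma card_edges_eq_add_degree: "card (edges G) = card {e \<in> edges G. v \<notin> e} + degree G v"
proof -
  have "edges G = {e \<in> edges G. v \<notin> e} \<union> {e \<in> edges G. v \<in> e}" by blast
  also have "card \<dots> = card {e \<in> edges G. v \<notin> e} + card {e \<in> edges G. v \<in> e}"
    using finite_edges by (intro card_Un_disjoint) auto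
  finally show ?thesis
    by (simp add: card_incident_edges)
qed

lemma sum_degree: "(\<Sum>v\<in>verts G. degree G v) = 2 * card (edges G)"
proof -
  have "card {v \<in> verts G. v \<in> e} = 2" if "e \<in> edges G" for e
  proof -
    have "e \<subseteq> verts G" "card e = 2"
      using G that by (auto simp: simple_graph_def)
    moreover from this have "{v \<in> verts G. v \<in> e} = e" by blast
    ultimately show ?thesis by simp
  qed
  then show ?thesis
    using sum_multicount[OF finite_verts finite_edges, of "(\<in>)" 2]
    by (simp add: card_incident_edges)
qed

lemma two_card_edges_le: "2 * card (edges G) \<le> card (verts G) ^ 2"
  using sum_bounded_above[of "verts G" "degree G" "card (verts G)"]
  by (simp add: degree_le_card_verts sum_degree power2_eq_square)

lemma card_edges_le_sum_degree:
  assumes "finite B" "\<And>e. e \<in> edges G \<Longrightarrow> e \<inter> B \<noteq> {}"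
  shows "card (edges G) \<le> (\<Sum>v\<in>B. degree G v)"
proof -
  have "edges G \<subseteq> (\<Union>v\<in>B. {e \<in> edges G. v \<in> e})"
    using assms(2) by blast
  then have "card (edges G) \<le> card (\<Union>v\<in>B. {e \<in> edges G. v \<in> e})"
    using assms(1) finite_edges by (intro card_mono) auto
  also have "\<dots> \<le> (\<Sum>v\<in>B. degree G v)"
    using card_UN_le[OF assms(1), of "\<lambda>v. {e \<in> edges G. v \<in> e}"] by (simp add: card_incident_edges)
  finally show ?thesis .
qed

lemma card_mult_le_sum_card_neighbours:
  fixes x :: real
  assumes "A \<subseteq> verts G" "min_degree_at_least G x"
  shows "card A * x \<le> (\<Sum>v\<in>verts G. real (card (neighbours G v \<inter> A)))"
proof -
  have "card A * x \<le> (\<Sum>a\<in>A. real (degree G a))"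
    using assms by (intro sum_bounded_below) (auto simp: min_degree_at_least_def)
  also have "\<dots> = (\<Sum>v\<in>verts G. card {a \<in> A. {v, a} \<in> edges G})"
  proof (subst sum_multicount_gen)
    have "{v \<in> verts G. {v, a} \<in> edges G} = neighbours G a" for a
      using edge_vertsD by (auto simp: insert_commute)
    then show "\<forall>a\<in>A. card {v \<in> verts G. {v, a} \<in> edges G} = degree G a"
      by (simp add: degree_def)
  qed (use assms(1) finite_verts finite_subset in auto)
  also have "\<dots> = (\<Sum>v\<in>verts G. card (neighbours G v \<inter> A))"
    by (intro arg_cong[of _ _ real] sum.cong arg_cong[of _ _ card]) auto
  finally show ?thesis by simp
qed

end

section \<open>Complete multipartite graphs and their deviation from a given graph\<close>

abbreviation colour_class :: "'a set \<Rightarrow> ('a \<Rightarrow> nat) \<Rightarrow> nat \<Rightarrow> 'a set" where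
  "colour_class V p i \<equiv> {v \<in> V. p v = i}"

definition complete_multipartite :: "'a set \<Rightarrow> ('a \<Rightarrow> nat) \<Rightarrow> 'a graph" where
  "complete_multipartite V p = Graph V {{u, v} | u v. u \<in> V \<and> v \<in> V \<and> p u \<noteq> p v}"

lemma verts_complete_multipartite [simp]: "verts (complete_multipartite V p) = V"
  by (simp add: complete_multipartite_def)

lemma edge_complete_multipartite_iff [simp]:
  "{u, v} \<in> edges (complete_multipartite V p) \<longleftrightarrow> u \<in> V \<and> v \<in> V \<and> p u \<noteq> p v"
  by (auto simp: complete_multipartite_def doubleton_eq_iff)

lemma simple_graph_complete_multipartite:
  "finite V \<Longrightarrow> simple_graph (complete_multipartite V p)"
  by (auto simp: simple_graph_def complete_multipartite_def card_2_iff)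

lemma sum_card_colour_class:
  assumes "finite V" "\<And>v. p v < k"
  shows "(\<Sum>i<k. card (colour_class V p i)) = card V"
  using sum.group[of V "{..<k}" p "\<lambda>_. 1 :: nat"] assms by fastforce

lemma card_edges_complete_multipartite:
  assumes V: "finite V" and p: "\<And>v. p v < k"
  shows "(\<Sum>i<k. card (colour_class V p i) ^ 2) + 2 * card (edges (complete_multipartite V p))
    = card V ^ 2"
proof -
  have deg: "degree (complete_multipartite V p) v + card (colour_class V p (p v)) = card V"
    if "v \<in> V" for v
  proof -
    have "card (neighbours (complete_multipartite V p) v \<union> colour_class V p (p v))
      = degree (complete_multipartite V p) v + card (colour_class V p (p v))"
      unfolding degree_def using V simple_graph_complete_multipartite[OF V, THEN finite_neighbours]
      by (intro card_Un_disjoint) auto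
    moreover have "neighbours (complete_multipartite V p) v \<union> colour_class V p (p v) = V"
      using that by auto
    ultimately show ?thesis by simp
  qed
  have "(\<Sum>i<k. card (colour_class V p i) ^ 2)
      = (\<Sum>i<k. \<Sum>v\<in>colour_class V p i. card (colour_class V p (p v)))"
    by (simp add: power2_eq_square)
  also have "\<dots> = (\<Sum>v\<in>V. card (colour_class V p (p v)))"
    using V p by (intro sum.group) auto
  finally have "(\<Sum>i<k. card (colour_class V p i) ^ 2) + 2 * card (edges (complete_multipartite V p))
      = (\<Sum>v\<in>V. degree (complete_multipartite V p) v + card (colour_class V p (p v)))"
    using sum_degree[OF simple_graph_complete_multipartite[OF V, of p]] by (simp add: sum.distrib)
  then show ?thesis
    using deg by (simp add: power2_eq_square)
qed

definition inner_graph :: "'a graph \<Rightarrow> ('a \<Rightarrow> nat) \<Rightarrow> 'a graph" where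
  "inner_graph G p = delete_edges G (edges (complete_multipartite (verts G) p))"

definition missing_graph :: "'a graph \<Rightarrow> ('a \<Rightarrow> nat) \<Rightarrow> 'a graph" where
  "missing_graph G p = delete_edges (complete_multipartite (verts G) p) (edges G)"

definition almost_k_partite :: "nat \<Rightarrow> 'a graph \<Rightarrow> real \<Rightarrow> bool" where
  "almost_k_partite k G x \<longleftrightarrow> (\<exists>p. (\<forall>v. p v < k) \<and> real (card (edges (inner_graph G p))) \<le> x)"

lemma almost_k_partite_mono: "almost_k_partite k G x \<Longrightarrow> x \<le> y \<Longrightarrow> almost_k_partite k G y"
  unfolding almost_k_partite_def by (meson order_trans)

lemma verts_inner_graph [simp]: "verts (inner_graph G p) = verts G"
  and verts_missing_graph [simp]: "verts (missing_graph G p) = verts G"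
  by (simp_all add: inner_graph_def missing_graph_def)

lemma edge_missing_graph_iff [simp]:
  "{u, v} \<in> edges (missing_graph G p) \<longleftrightarrow> u \<in> verts G \<and> v \<in> verts G \<and> p u \<noteq> p v \<and> {u, v} \<notin> edges G"
  by (auto simp: missing_graph_def)

lemma simple_graph_missing_graph: "simple_graph G \<Longrightarrow> simple_graph (missing_graph G p)"
  unfolding missing_graph_def
  by (intro simple_graph_delete_edges simple_graph_complete_multipartite finite_verts)

lemma sum_square_deviation:
  fixes q :: "nat \<Rightarrow> real"
  assumes "k > 0"
  shows "(\<Sum>i<k. (q i - (\<Sum>i<k. q i) / k)\<^sup>2) = (\<Sum>i<k. (q i)\<^sup>2) - (\<Sum>i<k. q i)\<^sup>2 / k"
proof -
  define m where "m = (\<Sum>i<k. q i) / k"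
  have "(\<Sum>i<k. (q i - m)\<^sup>2) = (\<Sum>i<k. (q i)\<^sup>2) - 2 * m * (\<Sum>i<k. q i) + k * m\<^sup>2"
    by (simp add: power2_diff sum.distrib sum_subtractf sum_distrib_left algebra_simps)
  then show ?thesis
    using assms by (simp add: m_def power2_eq_square field_simps)
qed

context
  fixes G :: "'a graph"
  assumes G: "simple_graph G"
begin

lemma simple_graph_inner_graph: "simple_graph (inner_graph G p)"
  unfolding inner_graph_def using G by (rule simple_graph_delete_edges)

lemma edge_inner_graph_iff: "{u, v} \<in> edges (inner_graph G p) \<longleftrightarrow> {u, v} \<in> edges G \<and> p u = p v"
  using edge_vertsD[OF G] by (auto simp: inner_graph_def)

lemma neighbours_inner_graph: "neighbours (inner_graph G p) v = colour_class (neighbours G v) p (p v)"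
  by (auto simp: edge_inner_graph_iff)

lemma card_inner_edges_le_if_cover_induced:
  assumes S: "S \<subseteq> verts G" and X: "X \<subseteq> S"
    and cover: "\<And>e. e \<in> edges (inner_graph (induced_subgraph G S) p) \<Longrightarrow> e \<inter> X \<noteq> {}"
  shows "card (edges (inner_graph G p)) \<le> (card X + card (verts G - S)) * card (verts G)"
proof -
  let ?Z = "X \<union> (verts G - S)"
  have "card (edges (inner_graph G p)) \<le> (\<Sum>v\<in>?Z. degree (inner_graph G p) v)"
  proof (rule card_edges_le_sum_degree[OF simple_graph_inner_graph])
    show "finite ?Z" using X S finite_verts[OF G] by (auto intro: finite_subset)
    fix e assume inner: "e \<in> edges (inner_graph G p)"
    then have "e \<in> edges G" by (simp add: inner_graph_def)
    then have "e \<subseteq> verts G" using G by (simp add: simple_graph_def)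
    show "e \<inter> ?Z \<noteq> {}"
    proof (cases "e \<subseteq> S")
      case True
      moreover have "edges (complete_multipartite S p) \<subseteq> edges (complete_multipartite (verts G) p)"
        using S unfolding complete_multipartite_def graph.sel by blast
      ultimately have "e \<in> edges (inner_graph (induced_subgraph G S) p)"
        using inner by (auto simp: inner_graph_def)
      then show ?thesis using cover by blast
    qed (use \<open>e \<subseteq> verts G\<close> in blast)
  qed
  also have "\<dots> \<le> card ?Z * card (verts G)"
    using degree_le_card_verts[OF simple_graph_inner_graph]
      sum_bounded_above[of ?Z "degree (inner_graph G p)" "card (verts G)"] by simp
  also have "\<dots> \<le> (card X + card (verts G - S)) * card (verts G)"
    by (intro mult_right_mono card_Un_le) simp
  finally show ?thesis .
qed

lemma k_partite_delete_inner_edges: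
  assumes "\<And>v. p v < k"
  shows "k_partite k (delete_edges G (edges (inner_graph G p)))"
  unfolding k_partite_def
proof (intro exI[of _ "colour_class (verts G) p"] conjI allI impI ballI notI)
  show "(\<Union>i<k. colour_class (verts G) p i) = verts (delete_edges G (edges (inner_graph G p)))"
    using assms by auto
  show "disjoint_family_on (colour_class (verts G) p) {..<k}"
    by (auto simp: disjoint_family_on_def)
  fix i e assume edge: "e \<in> edges (delete_edges G (edges (inner_graph G p)))"
    "e \<subseteq> colour_class (verts G) p i"
  then obtain u v where "e = {u, v}"
    by (auto elim: edgeE[OF G])
  then show False
    using edge by (auto simp: edge_inner_graph_iff)
qed

lemma almost_k_partiteD:
  assumes "almost_k_partite k G x"
  shows "\<exists>F \<subseteq> edges G. real (card F) \<le> x \<and> k_partite k (delete_edges G F)"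
proof -
  obtain p where "\<And>v. p v < k" "real (card (edges (inner_graph G p))) \<le> x"
    using assms by (auto simp: almost_k_partite_def)
  then show ?thesis
    using k_partite_delete_inner_edges[of p k]
    by (intro exI[of _ "edges (inner_graph G p)"]) (auto simp: inner_graph_def)
qed

lemma sum_square_deviation_add_missing:
  fixes k :: nat
  defines "n \<equiv> real (card (verts G))"
  assumes k: "k > 0" and p: "\<And>v. p v < k"
  shows "(\<Sum>i<k. (real (card (colour_class (verts G) p i)) - n / k)\<^sup>2)
      + 2 * card (edges (missing_graph G p))
    = (1 - 1 / k) * n\<^sup>2 - 2 * card (edges G) + 2 * card (edges (inner_graph G p))"
proof -
  define K where "K = complete_multipartite (verts G) p"
  define q where "q i = real (card (colour_class (verts G) p i))" for i
  have V: "finite (verts G)" by (rule finite_verts[OF G])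
  have "finite (edges K)"
    unfolding K_def by (intro finite_edges simple_graph_complete_multipartite V)
  have "card (edges K - edges G) + card (edges K \<inter> edges G) = card (edges K)"
    and "card (edges G - edges K) + card (edges K \<inter> edges G) = card (edges G)"
    using card_Diff_subset_Int[of "edges K" "edges G"] card_Diff_subset_Int[of "edges G" "edges K"]
      card_mono[of "edges K" "edges K \<inter> edges G"] card_mono[of "edges G" "edges K \<inter> edges G"]
      \<open>finite (edges K)\<close> finite_edges[OF G]
    by (auto simp: Int_commute)
  then have "card (edges (missing_graph G p)) + card (edges G)
      = card (edges K) + card (edges (inner_graph G p))"
    by (simp add: missing_graph_def inner_graph_def flip: K_def)
  moreover have "(\<Sum>i<k. (q i)\<^sup>2) + 2 * card (edges K) = n\<^sup>2"
    using card_edges_complete_multipartite[OF V p, THEN arg_cong[of _ _ real]]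
    by (simp add: q_def n_def K_def)
  moreover have "(\<Sum>i<k. q i) = n"
    using sum_card_colour_class[OF V p, THEN arg_cong[of _ _ real]] by (simp add: q_def n_def)
  then have "(\<Sum>i<k. (q i - n / k)\<^sup>2) = (\<Sum>i<k. (q i)\<^sup>2) - n\<^sup>2 / k"
    using sum_square_deviation[OF k, of q] by simp
  ultimately show ?thesis
    unfolding q_def[symmetric] by (simp add: algebra_simps)
qed

end

lemma card_residue_class:
  fixes k n i :: nat
  assumes "i < k"
  shows "card {v \<in> {..<n}. v mod k = i} = (n + (k - 1 - i)) div k"
proof (induction n)
  case 0
  then show ?case using assms by simp
next
  case (Suc n)
  have "{v \<in> {..<Suc n}. v mod k = i}
      = (if n mod k = i then insert n else id) {v \<in> {..<n}. v mod k = i}"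
    by (auto simp: less_Suc_eq)
  then have "card {v \<in> {..<Suc n}. v mod k = i}
      = card {v \<in> {..<n}. v mod k = i} + (if n mod k = i then 1 else 0)"
    by simp
  moreover have "Suc (n + (k - 1 - i)) mod k = 0 \<longleftrightarrow> n mod k = i"
  proof -
    have "Suc (n + (k - 1 - i)) = n + (k - i)" using assms by simp
    then have "Suc (n + (k - 1 - i)) mod k = (n mod k + (k - i)) mod k"
      by (simp only: mod_add_left_eq)
    moreover have "(r + (k - i)) mod k = 0 \<longleftrightarrow> r = i" if "r < k" for r
    proof (cases "r < i")
      case True
      then show ?thesis using assms by simp
    next
      case False
      then have "r + (k - i) = r - i + k" using assms by simp
      then have "(r + (k - i)) mod k = r - i"
        using that by (simp only: mod_add_self2) simp
      then show ?thesis using False by simp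
    qed
    ultimately show ?thesis using assms by simp
  qed
  ultimately show ?case
    using Suc by (simp add: div_Suc)
qed

lemma turan_graph_eq: "turan_graph k n = complete_multipartite {..<n} (\<lambda>v. v mod k)"
  by (simp add: turan_graph_def complete_multipartite_def)

lemma turan_number_lower_bound:
  assumes "k > 0"
  shows "(1 - 1 / k) * real n ^ 2 - k \<le> 2 * turan_number k n"
proof -
  define T where "T = turan_graph k n"
  define q where "q i = real (card {v \<in> {..<n}. v mod k = i})" for i
  have T: "simple_graph T"
    by (simp add: T_def turan_graph_eq simple_graph_complete_multipartite)
  have "(\<Sum>i<k. (q i - n / k)\<^sup>2) = (1 - 1 / k) * real n ^ 2 - 2 * turan_number k n"
    using sum_square_deviation_add_missing[OF T assms, of "\<lambda>v. v mod k"] assms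
    by (simp add: q_def T_def turan_graph_eq missing_graph_def inner_graph_def turan_number_def)
  moreover have "(\<Sum>i<k. (q i - n / k)\<^sup>2) \<le> (\<Sum>i<k. 1)"
  proof (rule sum_mono)
    fix i assume "i \<in> {..<k}"
    then have i: "i < k" by simp
    define m where "m = n + (k - 1 - i)"
    have "real k * real (m div k) + real (m mod k) = m"
      by (metis mult_div_mod_eq of_nat_add of_nat_mult)
    moreover have "real (m mod k) < k" "real n \<le> m" "real m + 1 \<le> real n + k"
      using i by (simp_all add: m_def)
    moreover have "q i = m div k"
      using card_residue_class[OF i, of n] by (simp add: q_def m_def)
    ultimately have "\<bar>k * q i - n\<bar> \<le> k" by (simp only: abs_le_iff) linarith
    then have "\<bar>q i - n / k\<bar> \<le> 1"
      using assms by (simp add: field_simps abs_le_iff)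
    then show "(q i - n / k)\<^sup>2 \<le> 1" by (simp add: abs_square_le_1)
  qed
  ultimately show ?thesis by simp
qed

lemma dense_if_almost_extremal:
  assumes "k > 0" "real (turan_number k n) - f \<le> m"
  shows "(1 - 1 / k) * real n ^ 2 - (2 * f + k) \<le> 2 * m"
  using turan_number_lower_bound[OF assms(1), of n] assms(2) by simp

section \<open>Completely joined families of classes\<close>

definition mutually_complete :: "'a graph \<Rightarrow> nat set \<Rightarrow> (nat \<Rightarrow> 'a set) \<Rightarrow> bool" where
  "mutually_complete G I D \<longleftrightarrow> (\<forall>i\<in>I. D i \<subseteq> verts G) \<and>
     (\<forall>i\<in>I. \<forall>j\<in>I. i \<noteq> j \<longrightarrow> complete_between (D i) (D j) \<subseteq> edges G)"

definition blown_up_clique :: "'a graph \<Rightarrow> nat \<Rightarrow> nat \<Rightarrow> (nat \<Rightarrow> 'a set) \<Rightarrow> bool" where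
  "blown_up_clique G r t D \<longleftrightarrow> mutually_complete G {..<r} D \<and> (\<forall>i<r. card (D i) = t)"

lemma mutually_complete_vertsD: "mutually_complete G I D \<Longrightarrow> i \<in> I \<Longrightarrow> D i \<subseteq> verts G"
  by (simp add: mutually_complete_def)

lemma mutually_complete_edgeD:
  "mutually_complete G I D \<Longrightarrow> i \<in> I \<Longrightarrow> j \<in> I \<Longrightarrow> i \<noteq> j \<Longrightarrow> x \<in> D i \<Longrightarrow> y \<in> D j
    \<Longrightarrow> {x, y} \<in> edges G"
  by (meson complete_between_subset_iff mutually_complete_def)

lemma mutually_complete_mono:
  assumes "mutually_complete G I D" "\<And>i. i \<in> I \<Longrightarrow> C i \<subseteq> D i"
  shows "mutually_complete G I C"
  using assms unfolding mutually_complete_def complete_between_subset_iff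
  by (meson subsetD subset_trans)

lemma mutually_complete_insert:
  assumes "mutually_complete G I D" "r \<notin> I" "W \<subseteq> verts G"
    and "\<And>i. i \<in> I \<Longrightarrow> complete_between W (D i) \<subseteq> edges G"
  shows "mutually_complete G (insert r I) (D(r := W))"
proof -
  have "{x, y} \<in> edges G \<and> {y, x} \<in> edges G" if "i \<in> I" "x \<in> W" "y \<in> D i" for i x y
    using assms(4) that by (auto simp: complete_between_subset_iff insert_commute)
  then show ?thesis
    using assms(1-3) unfolding mutually_complete_def complete_between_subset_iff by auto
qed

lemma disjoint_family_on_mutually_complete:
  assumes "simple_graph G" "mutually_complete G I D"
  shows "disjoint_family_on D I"
  using assms disjoint_if_complete_between
  by (fastforce simp: mutually_complete_def disjoint_family_on_def)

lemma exists_subsets_avoiding: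
  assumes "finite B" "\<And>i. i < r \<Longrightarrow> card B + t \<le> card (A i)"
  shows "\<exists>W. \<forall>i<r. W i \<subseteq> A i - B \<and> card (W i) = t"
proof -
  have "\<exists>W. W \<subseteq> A i - B \<and> card W = t" if "i < r" for i
  proof -
    have "t \<le> card (A i - B)"
      using assms(2)[OF that] diff_card_le_card_Diff[OF assms(1), of "A i"] by linarith
    then show ?thesis by (meson obtain_subset_with_card_n)
  qed
  then show ?thesis by metis
qed

lemma blown_up_cliqueI_card_ge:
  assumes "mutually_complete G {..<r} C" "\<And>i. i < r \<Longrightarrow> t \<le> card (C i)"
  obtains D where "blown_up_clique G r t D"
proof -
  obtain D where "\<forall>i<r. D i \<subseteq> C i - {} \<and> card (D i) = t"
    using exists_subsets_avoiding[of "{}" r t C] assms(2) by auto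
  then show thesis
    using mutually_complete_mono[OF assms(1), of D]
    by (intro that[of D]) (auto simp: blown_up_clique_def)
qed

lemma card_UN_blown_up_clique:
  assumes "simple_graph G" "blown_up_clique G r t D"
  shows "card (\<Union>i<r. D i) = r * t"
proof -
  have joined: "mutually_complete G {..<r} D" and card: "\<And>i. i < r \<Longrightarrow> card (D i) = t"
    using assms(2) by (auto simp: blown_up_clique_def)
  have "card (\<Union>i<r. D i) = (\<Sum>i<r. card (D i))"
  proof (rule card_UN_disjoint)
    show "\<forall>i\<in>{..<r}. finite (D i)"
      using mutually_complete_vertsD[OF joined] finite_verts[OF assms(1)] finite_subset by blast
    show "\<forall>i\<in>{..<r}. \<forall>j\<in>{..<r}. i \<noteq> j \<longrightarrow> D i \<inter> D j = {}"
      using disjoint_family_on_mutually_complete[OF assms(1) joined] by (simp add: disjoint_family_on_def)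
  qed simp
  then show ?thesis by (simp add: card)
qed

lemma card_Int_UN_add_le:
  assumes "finite I" "J \<subseteq> I" and D: "\<And>i. i \<in> I \<Longrightarrow> finite (D i) \<and> card (D i) \<le> t"
  shows "card (N \<inter> (\<Union>i\<in>I. D i)) + card J * t \<le> card I * t + (\<Sum>j\<in>J. card (N \<inter> D j))"
proof -
  have "card (N \<inter> (\<Union>i\<in>I. D i)) \<le> (\<Sum>i\<in>I. card (N \<inter> D i))"
    unfolding Int_UN_distrib by (rule card_UN_le[OF assms(1)])
  also have "\<dots> = (\<Sum>i\<in>I - J. card (N \<inter> D i)) + (\<Sum>j\<in>J. card (N \<inter> D j))"
    by (rule sum.subset_diff[OF assms(2,1)])
  also have "(\<Sum>i\<in>I - J. card (N \<inter> D i)) \<le> card (I - J) * t"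
  proof -
    have "card (N \<inter> D i) \<le> t" if "i \<in> I - J" for i
      using D[of i] that card_mono[of "D i" "N \<inter> D i"] by fastforce
    then show ?thesis
      using sum_bounded_above[of "I - J" "\<lambda>i. card (N \<inter> D i)" t] by simp
  qed
  finally have "card (N \<inter> (\<Union>i\<in>I. D i)) + card J * t
      \<le> (card (I - J) + card J) * t + (\<Sum>j\<in>J. card (N \<inter> D j))"
    by (simp add: algebra_simps)
  also have "card (I - J) + card J = card I"
    using assms(1,2) by (metis card_Diff_subset card_mono finite_subset le_add_diff_inverse2)
  finally show ?thesis .
qed

section \<open>Properties of all large graphs\<close>

definition large_graphs :: "'a graph filter" where
  "large_graphs = inf (filtercomap (\<lambda>G. card (verts G)) at_top) (principal {G. simple_graph G})"

lemma eventually_large_graphs: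
  "eventually P large_graphs \<longleftrightarrow> (\<exists>n0. \<forall>G. simple_graph G \<longrightarrow> n0 \<le> card (verts G) \<longrightarrow> P G)"
  unfolding large_graphs_def eventually_inf_principal eventually_filtercomap_at_top_linorder
  by blast

lemma eventually_large_graphsD:
  assumes "eventually P large_graphs"
  shows "\<forall>\<^sub>F n in sequentially. \<forall>G. simple_graph G \<longrightarrow> card (verts G) = n \<longrightarrow> P G"
  using assms unfolding eventually_large_graphs eventually_sequentially by blast

lemma eventually_simple_graph: "\<forall>\<^sub>F G in large_graphs. simple_graph G"
  by (simp add: eventually_large_graphs)

lemma eventually_le_mult_card_verts:
  fixes x y :: real
  assumes "0 < y"
  shows "\<forall>\<^sub>F G in large_graphs. x \<le> y * card (verts G)"
proof -
  obtain n0 :: nat where "x / y \<le> n0" using real_arch_simple by blast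
  have "x \<le> y * n" if "n0 \<le> n" for n :: nat
  proof -
    have "x / y \<le> n" using \<open>x / y \<le> n0\<close> that by linarith
    then show ?thesis using assms by (simp add: field_simps)
  qed
  then show ?thesis
    unfolding eventually_large_graphs by blast
qed

lemma eventually_le_mult_card_verts_square:
  fixes x y :: real
  assumes "0 < y"
  shows "\<forall>\<^sub>F G in large_graphs. x \<le> y * real (card (verts G)) ^ 2"
  using eventually_le_mult_card_verts[OF assms, of x] eventually_le_mult_card_verts[OF zero_less_one, of 1]
proof eventually_elim
  case (elim G)
  have "y * real (card (verts G)) \<le> y * real (card (verts G)) ^ 2"
    using elim(2) assms by (intro mult_left_mono) (auto simp: power2_eq_square)
  then show ?case using elim(1) by linarith
qed

section \<open>Blown-up cliques in graphs of large minimum degree\<close>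

lemma sum_add_card_mult_le:
  fixes f :: "'a \<Rightarrow> real" and u w :: real
  assumes "finite V" "X \<subseteq> V" "\<And>v. v \<in> V \<Longrightarrow> f v \<le> u" "\<And>v. v \<in> X \<Longrightarrow> f v + w \<le> u"
  shows "(\<Sum>v\<in>V. f v) + card X * w \<le> card V * u"
proof -
  have "(\<Sum>v\<in>V. f v) + card X * w = (\<Sum>v\<in>V - X. f v) + (\<Sum>v\<in>X. f v + w)"
    by (simp add: sum.subset_diff[OF assms(2,1)] sum.distrib)
  also have "\<dots> \<le> (\<Sum>v\<in>V - X. u) + (\<Sum>v\<in>X. u)"
    using assms(3,4) by (intro add_mono sum_mono) auto
  also have "\<dots> = (\<Sum>v\<in>V. u)"
    by (rule sum.subset_diff[OF assms(2,1), symmetric])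
  finally show ?thesis by simp
qed

context
  fixes G :: "'a graph"
  assumes G: "simple_graph G"
begin

lemma card_neighbours_blown_up_clique_le:
  assumes D: "blown_up_clique G r t D" and J: "J \<subseteq> {..<r}"
  shows "card (neighbours G v \<inter> (\<Union>i<r. D i)) + card J * t
    \<le> r * t + (\<Sum>j\<in>J. card (neighbours G v \<inter> D j))"
proof -
  have "finite (D i) \<and> card (D i) \<le> t" if "i \<in> {..<r}" for i
    using D that mutually_complete_vertsD[of G "{..<r}" D i] finite_verts[OF G] finite_subset
    by (auto simp: blown_up_clique_def)
  then show ?thesis
    using card_Int_UN_add_le[OF _ J, of D t "neighbours G v"] by simp
qed

lemma sum_card_neighbours_blown_up_clique_ge:
  fixes x :: real
  assumes "blown_up_clique G r t D" "min_degree_at_least G x"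
  shows "r * t * x \<le> (\<Sum>v\<in>verts G. real (card (neighbours G v \<inter> (\<Union>i<r. D i))))"
proof -
  have "(\<Union>i<r. D i) \<subseteq> verts G"
    using assms(1) mutually_complete_vertsD by (fastforce simp: blown_up_clique_def)
  from card_mult_le_sum_card_neighbours[OF G this assms(2)]
  show ?thesis by (simp add: card_UN_blown_up_clique[OF G assms(1)])
qed

lemma many_vertices_with_many_neighbours_in_each_class:
  fixes \<theta> :: real
  assumes D: "blown_up_clique G r t' D"
    and deg: "min_degree_at_least G ((1 - \<theta>) * card (verts G))"
    and t': "real t + 1 \<le> t' * (1 - r * \<theta>)"
  shows "card (verts G) \<le> t' * card {v \<in> verts G. \<forall>i<r. t \<le> card (neighbours G v \<inter> D i)}"
proof -
  define N where "N v = card (neighbours G v \<inter> (\<Union>i<r. D i))" for v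
  define Y where "Y = {v \<in> verts G. \<forall>i<r. t \<le> card (neighbours G v \<inter> D i)}"
  define n where "n = real (card (verts G))"
  have V: "finite (verts G)" and Y: "Y \<subseteq> verts G"
    by (auto simp: finite_verts[OF G] Y_def)
  have "(\<Sum>v\<in>verts G. real (N v)) + card (verts G - Y) * (real t' - t) \<le> n * (r * t')"
    unfolding n_def
  proof (rule sum_add_card_mult_le[OF V])
    show "real (N v) \<le> r * t'" for v
      using card_neighbours_blown_up_clique_le[OF D, of "{}" v]
      by (simp add: N_def flip: of_nat_mult)
    fix v assume "v \<in> verts G - Y"
    then obtain i where "i < r" "card (neighbours G v \<inter> D i) \<le> t"
      by (auto simp: Y_def not_le intro: less_imp_le)
    then have "N v + t' \<le> r * t' + t"
      using card_neighbours_blown_up_clique_le[OF D, of "{i}" v] by (simp add: N_def)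
    then show "real (N v) + (real t' - t) \<le> r * t'"
      by (simp flip: of_nat_add of_nat_mult)
  qed auto
  moreover have "r * t' * ((1 - \<theta>) * n) \<le> (\<Sum>v\<in>verts G. real (N v))"
    using sum_card_neighbours_blown_up_clique_ge[OF D deg] by (simp add: N_def n_def)
  moreover have "real (card (verts G - Y)) = n - card Y"
    using V Y by (simp add: n_def card_Diff_subset finite_subset card_mono)
  ultimately have "n * (t' * (1 - r * \<theta>) - t) \<le> card Y * (real t' - t)"
    by (simp add: algebra_simps)
  moreover have "n * 1 \<le> n * (t' * (1 - r * \<theta>) - t)"
    using t' by (intro mult_left_mono) (auto simp: n_def)
  moreover have "card Y * (real t' - t) \<le> real (card Y) * t'"
    by (intro mult_left_mono) auto
  ultimately have "n \<le> t' * real (card Y)" by (simp add: mult.commute)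
  then have "real (card (verts G)) \<le> real (t' * card Y)" by (simp add: n_def)
  then show ?thesis by (simp only: of_nat_le_iff Y_def)
qed

lemma common_trace_pigeonhole:
  assumes "finite A" "finite Y"
  obtains B where "card Y \<le> card {v \<in> Y. neighbours G v \<inter> A = B} * 2 ^ card A"
proof -
  have "\<exists>B\<in>Pow A. card Y \<le> card ((\<lambda>v. neighbours G v \<inter> A) -` {B} \<inter> Y) * card (Pow A)"
    using assms by (intro pigeonhole_card) auto
  moreover have "(\<lambda>v. neighbours G v \<inter> A) -` {B} \<inter> Y = {v \<in> Y. neighbours G v \<inter> A = B}" for B
    by auto
  ultimately show thesis
    using that by (auto simp: card_Pow[OF assms(1)])
qed

lemma many_vertices_with_common_trace:
  fixes \<theta> :: real
  assumes D: "blown_up_clique G r t' D"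
    and deg: "min_degree_at_least G ((1 - \<theta>) * card (verts G))"
    and t': "real t + 1 \<le> t' * (1 - r * \<theta>)"
    and size: "t' * (t * 2 ^ (r * t')) \<le> card (verts G)" "0 < card (verts G)"
  obtains B W where "W \<subseteq> verts G" "t \<le> card W" "0 < card W"
    "\<And>v i. v \<in> W \<Longrightarrow> i < r \<Longrightarrow> t \<le> card (neighbours G v \<inter> D i)"
    "\<And>v i. v \<in> W \<Longrightarrow> i < r \<Longrightarrow> B \<inter> D i = neighbours G v \<inter> D i"
proof -
  define A where "A = (\<Union>i<r. D i)"
  define Y where "Y = {v \<in> verts G. \<forall>i<r. t \<le> card (neighbours G v \<inter> D i)}"
  have "finite Y" "finite A"
    using finite_verts[OF G] finite_subset[OF mutually_complete_vertsD[of G "{..<r}" D]] D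
    by (auto simp: Y_def A_def blown_up_clique_def)
  have "card (verts G) \<le> t' * card Y"
    unfolding Y_def by (rule many_vertices_with_many_neighbours_in_each_class[OF D deg t'])
  then have "t' * (t * 2 ^ (r * t')) \<le> t' * card Y" "0 < t' * card Y"
    using size by linarith+
  then have Y: "t * 2 ^ (r * t') \<le> card Y" "0 < card Y" by simp_all
  obtain B where B: "card Y \<le> card {v \<in> Y. neighbours G v \<inter> A = B} * 2 ^ card A"
    by (rule common_trace_pigeonhole[OF \<open>finite A\<close> \<open>finite Y\<close>])
  define W where "W = {v \<in> Y. neighbours G v \<inter> A = B}"
  have "card Y \<le> card W * 2 ^ (r * t')"
    using B card_UN_blown_up_clique[OF G D] by (simp add: W_def A_def)
  then have "t * 2 ^ (r * t') \<le> card W * 2 ^ (r * t')" "0 < card W * 2 ^ (r * t')"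
    using Y by linarith+
  then have "t \<le> card W" "0 < card W" by simp_all
  then show thesis
    by (rule that[of W B, rotated]) (auto simp: W_def Y_def A_def)
qed

lemma blown_up_clique_Suc:
  fixes \<theta> :: real
  assumes D: "blown_up_clique G r t' D"
    and deg: "min_degree_at_least G ((1 - \<theta>) * card (verts G))"
    and t': "real t + 1 \<le> t' * (1 - r * \<theta>)"
    and size: "t' * (t * 2 ^ (r * t')) \<le> card (verts G)" "0 < card (verts G)"
  obtains D' where "blown_up_clique G (Suc r) t D'"
proof -
  obtain B W where W: "W \<subseteq> verts G" "t \<le> card W" "0 < card W"
    "\<And>v i. v \<in> W \<Longrightarrow> i < r \<Longrightarrow> t \<le> card (neighbours G v \<inter> D i)"
    "\<And>v i. v \<in> W \<Longrightarrow> i < r \<Longrightarrow> B \<inter> D i = neighbours G v \<inter> D i"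
    by (rule many_vertices_with_common_trace[OF assms]) blast
  have D_joined: "mutually_complete G {..<r} D"
    using D by (simp add: blown_up_clique_def)
  show thesis
  proof (rule blown_up_cliqueI_card_ge[OF _ _ that])
    show "mutually_complete G {..<Suc r} ((\<lambda>i. B \<inter> D i)(r := W))"
      unfolding lessThan_Suc
    proof (rule mutually_complete_insert)
      show "mutually_complete G {..<r} (\<lambda>i. B \<inter> D i)"
        by (rule mutually_complete_mono[OF D_joined]) auto
      show "complete_between W (B \<inter> D i) \<subseteq> edges G" if "i \<in> {..<r}" for i
        using that W(5)[of _ i] unfolding complete_between_subset_iff by auto
    qed (use W(1) in auto)
    obtain v where "v \<in> W" using W(3) by fastforce
    then have "t \<le> card (B \<inter> D i)" if "i < r" for i
      using W(4,5) that by simp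
    then show "t \<le> card (((\<lambda>i. B \<inter> D i)(r := W)) i)" if "i < Suc r" for i
      using that W(2) by (auto simp: less_Suc_eq)
  qed
qed

end

lemma erdos_stone_min_degree:
  fixes \<theta> :: real
  assumes "\<And>i. i < r \<Longrightarrow> real i * \<theta> < 1"
  shows "\<forall>\<^sub>F G :: 'b graph in large_graphs. min_degree_at_least G ((1 - \<theta>) * card (verts G)) \<longrightarrow>
    (\<exists>D. blown_up_clique G r t D)"
  using assms
proof (induction r arbitrary: t)
  case 0
  show ?case by (simp add: blown_up_clique_def mutually_complete_def)
next
  case (Suc r)
  have pos: "1 - r * \<theta> > 0" using Suc.prems[of r] by simp
  obtain t' :: nat where "(real t + 1) / (1 - r * \<theta>) \<le> t'"
    using real_arch_simple by blast
  then have t': "real t + 1 \<le> t' * (1 - r * \<theta>)"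
    using pos by (simp add: field_simps)
  have "\<forall>\<^sub>F G :: 'b graph in large_graphs. min_degree_at_least G ((1 - \<theta>) * card (verts G)) \<longrightarrow>
      (\<exists>D. blown_up_clique G r t' D)"
    using Suc.prems by (intro Suc.IH) simp
  moreover note eventually_simple_graph
  moreover have "\<forall>\<^sub>F G :: 'b graph in large_graphs.
      real (t' * (t * 2 ^ (r * t')) + 1) \<le> 1 * real (card (verts G))"
    by (rule eventually_le_mult_card_verts) simp
  ultimately show ?case
  proof eventually_elim
    case (elim G)
    show ?case
    proof
      assume deg: "min_degree_at_least G ((1 - \<theta>) * card (verts G))"
      then obtain D where D: "blown_up_clique G r t' D" using elim(1) by blast
      have "t' * (t * 2 ^ (r * t')) + 1 \<le> card (verts G)"
        using elim(3) by (simp only: mult_1 of_nat_le_iff)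
      then obtain D' where "blown_up_clique G (Suc r) t D'"
        using blown_up_clique_Suc[OF elim(2) D deg t'] by auto
      then show "\<exists>D. blown_up_clique G (Suc r) t D" by blast
    qed
  qed
qed

section \<open>Embedding into blow-ups\<close>

lemma is_subgraph_if_classes_joined:
  fixes c :: "'a \<Rightarrow> 'i"
  assumes H: "simple_graph H" and G: "simple_graph G"
    and D: "\<And>v. v \<in> verts H \<Longrightarrow> D (c v) \<subseteq> verts G"
    and card: "\<And>v. v \<in> verts H \<Longrightarrow> card {w \<in> verts H. c w = c v} \<le> card (D (c v))"
    and disj: "\<And>v w. v \<in> verts H \<Longrightarrow> w \<in> verts H \<Longrightarrow> c v \<noteq> c w \<Longrightarrow> D (c v) \<inter> D (c w) = {}"
    and joined: "\<And>v w. {v, w} \<in> edges H \<Longrightarrow> complete_between (D (c v)) (D (c w)) \<subseteq> edges G"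
  shows "is_subgraph H G"
proof -
  have "\<exists>g. g ` {w \<in> verts H. c w = i} \<subseteq> D i \<and> inj_on g {w \<in> verts H. c w = i}"
    if "i \<in> c ` verts H" for i
  proof (rule card_le_inj)
    obtain v where v: "v \<in> verts H" "i = c v" using \<open>i \<in> c ` verts H\<close> by blast
    show "finite (D i)" using D[OF v(1)] v(2) finite_verts[OF G] finite_subset by blast
    show "card {w \<in> verts H. c w = i} \<le> card (D i)" using card[OF v(1)] v(2) by simp
  qed (simp add: finite_verts[OF H])
  then have "\<forall>i\<in>c ` verts H. \<exists>g. g ` {w \<in> verts H. c w = i} \<subseteq> D i \<and> inj_on g {w \<in> verts H. c w = i}"
    by blast
  from bchoice[OF this]
  obtain g where g: "\<And>i. i \<in> c ` verts H \<Longrightarrow> g i ` {w \<in> verts H. c w = i} \<subseteq> D i"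
    and g_inj: "\<And>i. i \<in> c ` verts H \<Longrightarrow> inj_on (g i) {w \<in> verts H. c w = i}"
    by blast
  define \<phi> where "\<phi> v = g (c v) v" for v
  have \<phi>: "\<phi> v \<in> D (c v)" if "v \<in> verts H" for v
    using g[of "c v"] that by (auto simp: \<phi>_def)
  have "inj_on \<phi> (verts H)"
  proof (rule inj_onI)
    fix v w assume vw: "v \<in> verts H" "w \<in> verts H" "\<phi> v = \<phi> w"
    then have "c v = c w" using \<phi>[of v] \<phi>[of w] disj[of v w] by auto
    then show "v = w"
      using vw g_inj[of "c w"] by (auto simp: \<phi>_def dest: inj_onD)
  qed
  moreover have "\<phi> ` verts H \<subseteq> verts G" using \<phi> D by blast
  moreover have "\<phi> ` e \<in> edges G" if e: "e \<in> edges H" for e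
  proof -
    obtain v w where "e = {v, w}" "v \<in> verts H" "w \<in> verts H" using edgeE[OF H e] .
    then show ?thesis
      using joined[of v w] e \<phi> by (simp add: complete_between_subset_iff)
  qed
  ultimately show ?thesis unfolding is_subgraph_def by blast
qed

lemma edge_blown_up_mycielskian_cases:
  assumes "{x, y} \<in> edges (blown_up_mycielskian k a b c)"
  shows "case (x, y) of
      (MV i _, MV j _) \<Rightarrow> i < k \<and> j < k \<and> i \<noteq> j
    | (MV i _, MW j _) \<Rightarrow> i < k \<and> j < k \<and> i \<noteq> j
    | (MW i _, MV j _) \<Rightarrow> i < k \<and> j < k \<and> i \<noteq> j
    | (MW i _, MU _) \<Rightarrow> i < k
    | (MU _, MW i _) \<Rightarrow> i < k
    | _ \<Rightarrow> False"
  using assms unfolding blown_up_mycielskian_def Let_def graph.sel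
  by (elim UnE UN_E) (auto simp: complete_between_def doubleton_eq_iff)

lemma verts_blown_up_mycielskian:
  "verts (blown_up_mycielskian k a b c) =
    {MV i j | i j. i < k \<and> j < a} \<union> {MW i j | i j. i < k \<and> j < b} \<union> {MU j | j. j < c}"
  by (auto simp: blown_up_mycielskian_def)

lemma simple_graph_blown_up_mycielskian: "simple_graph (blown_up_mycielskian k a b c)"
  unfolding simple_graph_def
proof (intro conjI ballI)
  show "finite (verts (blown_up_mycielskian k a b c))"
    by (simp add: blown_up_mycielskian_def Let_def)
  fix e assume "e \<in> edges (blown_up_mycielskian k a b c)"
  then have "e \<subseteq> verts (blown_up_mycielskian k a b c) \<and> card e = 2"
    unfolding blown_up_mycielskian_def Let_def graph.sel
    by (elim UnE UN_E) (auto simp: complete_between_def)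
  then show "e \<subseteq> verts (blown_up_mycielskian k a b c)" "card e = 2"
    by simp_all
qed

lemma is_subgraph_blown_up_mycielskian:
  assumes G: "simple_graph G" and D: "mutually_complete G {..<k} D"
    and W: "\<And>i. i < k \<Longrightarrow> W i \<subseteq> verts G" "disjoint_family_on W {..<k}"
    and U: "U \<subseteq> verts G" "\<And>i. i < k \<Longrightarrow> U \<inter> D i = {}"
    and DW: "\<And>i. i < k \<Longrightarrow> D i \<inter> W i = {}"
    and card: "\<And>i. i < k \<Longrightarrow> a \<le> card (D i)" "\<And>i. i < k \<Longrightarrow> b \<le> card (W i)" "c \<le> card U"
    and DW_edges: "\<And>i j. i < k \<Longrightarrow> j < k \<Longrightarrow> i \<noteq> j \<Longrightarrow> complete_between (D i) (W j) \<subseteq> edges G"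
    and WU_edges: "\<And>i. i < k \<Longrightarrow> complete_between (W i) U \<subseteq> edges G"
  shows "is_subgraph (blown_up_mycielskian k a b c) G"
proof -
  define cls where "cls m = (case m of MV i j \<Rightarrow> MV i 0 | MW i j \<Rightarrow> MW i 0 | MU j \<Rightarrow> MU 0)" for m
  define C where "C m = (case m of MV i j \<Rightarrow> D i | MW i j \<Rightarrow> W i | MU j \<Rightarrow> U)" for m
  let ?M = "blown_up_mycielskian k a b c"
  have cls_simps [simp]: "cls (MV i j) = MV i 0" "cls (MW i j) = MW i 0" "cls (MU j) = MU 0" for i j
    by (simp_all add: cls_def)
  have C_simps [simp]: "C (MV i j) = D i" "C (MW i j) = W i" "C (MU j) = U" for i j
    by (simp_all add: C_def)
  have fibres: "{w \<in> verts ?M. cls w = MV i 0} = MV i ` {..<a}"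
    "{w \<in> verts ?M. cls w = MW i 0} = MW i ` {..<b}" if "i < k" for i
    using that by (auto simp: verts_blown_up_mycielskian)
  have fibre_U: "{w \<in> verts ?M. cls w = MU 0} = MU ` {..<c}"
    by (auto simp: verts_blown_up_mycielskian)
  show ?thesis
  proof (rule is_subgraph_if_classes_joined
      [where c = cls and D = C, OF simple_graph_blown_up_mycielskian G])
    show "C (cls v) \<subseteq> verts G" if "v \<in> verts ?M" for v
      using that W(1) U(1) mutually_complete_vertsD[OF D]
      by (cases v) (auto simp: verts_blown_up_mycielskian)
    show "card {w \<in> verts ?M. cls w = cls v} \<le> card (C (cls v))" if "v \<in> verts ?M" for v
      using that card fibres fibre_U
      by (cases v) (auto simp: verts_blown_up_mycielskian card_image inj_on_def)
    have "D i \<inter> D j = {}" "W i \<inter> W j = {}" if "i < k" "j < k" "i \<noteq> j" for i j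
      using that disjoint_family_on_mutually_complete[OF G D] W(2) by (simp_all add: disjoint_family_on_def)
    moreover have "D i \<inter> W j = {}" "W j \<inter> D i = {}" if "i < k" "j < k" for i j
      using that DW disjoint_if_complete_between[OF G DW_edges] by (cases "i = j"; force)+
    moreover have "W i \<inter> U = {}" "U \<inter> W i = {}" "D i \<inter> U = {}" if "i < k" for i
      using disjoint_if_complete_between[OF G WU_edges[OF that]] U(2)[OF that] by auto
    ultimately show "C (cls v) \<inter> C (cls w) = {}"
      if "v \<in> verts ?M" "w \<in> verts ?M" "cls v \<noteq> cls w" for v w
      using that U(2) by (cases v; cases w) (simp_all add: verts_blown_up_mycielskian)
    have "complete_between (D i) (D j) \<subseteq> edges G" if "i < k" "j < k" "i \<noteq> j" for i j
      using that D by (simp add: mutually_complete_def)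
    then show "complete_between (C (cls v)) (C (cls w)) \<subseteq> edges G" if "{v, w} \<in> edges ?M" for v w
      using edge_blown_up_mycielskian_cases[OF that] DW_edges WU_edges
      by (cases v; cases w) (simp_all add: complete_between_commute)
  qed
qed

lemma proper_colouring_chromatic_number:
  assumes G: "simple_graph G"
  shows "\<exists>c. proper_colouring G (chromatic_number G) c"
proof -
  obtain g where "bij_betw g (verts G) {0..<card (verts G)}"
    using ex_bij_betw_finite_nat[OF finite_verts[OF G]] by blast
  then have "proper_colouring G (card (verts G)) g"
    using edge_vertsD[OF G] unfolding proper_colouring_def
    by (fastforce simp: bij_betw_def inj_on_eq_iff)
  then have "\<exists>k c. proper_colouring G k c" by blast
  then show ?thesis
    unfolding chromatic_number_def by (rule LeastI_ex)
qed

lemma critical_edge_colouring: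
  assumes H: "simple_graph H" and crit: "critical_edge H e" and chi: "chromatic_number H = k + 1"
    and i: "i < k"
  obtains u v c where "e = {u, v}" "u \<noteq> v" "u \<in> verts H" "v \<in> verts H" "c u = i" "c v = i"
    "\<And>x. x \<in> verts H \<Longrightarrow> c x < k" "\<And>x y. {x, y} \<in> edges H \<Longrightarrow> {x, y} \<noteq> e \<Longrightarrow> c x \<noteq> c y"
proof -
  let ?H = "delete_edges H {e}"
  have e: "e \<in> edges H" and "chromatic_number ?H = k"
    using crit chi by (auto simp: critical_edge_def)
  then obtain c where c: "proper_colouring ?H k c"
    using proper_colouring_chromatic_number[OF simple_graph_delete_edges[OF H]] by blast
  obtain u v where uv: "e = {u, v}" "u \<noteq> v" "u \<in> verts H" "v \<in> verts H"
    using edgeE[OF H e] .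
  have range: "c x < k" if "x \<in> verts H" for x
    using c that by (auto simp: proper_colouring_def)
  have proper: "c x \<noteq> c y" if "{x, y} \<in> edges H" "{x, y} \<noteq> e" for x y
    using c that by (simp add: proper_colouring_def)
  have "c u = c v"
  proof (rule ccontr)
    assume "c u \<noteq> c v"
    then have "proper_colouring H k c"
      using range proper uv(1) unfolding proper_colouring_def by (auto, metis doubleton_eq_iff)
    then have "chromatic_number H \<le> k"
      unfolding chromatic_number_def by (intro Least_le) blast
    then show False using chi by simp
  qed
  let ?\<tau> = "Transposition.transpose (c u) i"
  show thesis
  proof (rule that[OF uv])
    show "(?\<tau> \<circ> c) u = i" "(?\<tau> \<circ> c) v = i" using \<open>c u = c v\<close> by simp_all
    show "(?\<tau> \<circ> c) x < k" if "x \<in> verts H" for x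
      using range[OF that] range[OF uv(3)] i by (simp add: Transposition.transpose_def)
    show "(?\<tau> \<circ> c) x \<noteq> (?\<tau> \<circ> c) y" if "{x, y} \<in> edges H" "{x, y} \<noteq> e" for x y
      using proper[OF that] by (simp add: inj_eq[OF inj_transpose])
  qed
qed

lemma critical_edge_split_colouring:
  assumes "simple_graph H" "critical_edge H e" "chromatic_number H = k + 1" "i < k"
  obtains c where "\<And>w. w \<in> verts H \<Longrightarrow> c w < k + 2"
    "\<And>j. k \<le> j \<Longrightarrow> card {w \<in> verts H. c w = j} \<le> 1"
    "\<And>w w'. {w, w'} \<in> edges H \<Longrightarrow> c w \<noteq> c w'"
    "\<And>w w'. {w, w'} \<in> edges H \<Longrightarrow> k \<le> c w \<Longrightarrow> c w' \<noteq> i"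
proof -
  obtain u v c where uv: "e = {u, v}" "u \<noteq> v" "c u = i" "c v = i"
    and range: "\<And>w. w \<in> verts H \<Longrightarrow> c w < k"
    and proper: "\<And>w w'. {w, w'} \<in> edges H \<Longrightarrow> {w, w'} \<noteq> e \<Longrightarrow> c w \<noteq> c w'"
    by (rule critical_edge_colouring[OF assms]) blast
  define c' where "c' w = (if w = u then k else if w = v then Suc k else c w)" for w
  show thesis
  proof (rule that[of c'])
    show "c' w < k + 2" if "w \<in> verts H" for w
      using range[OF that] by (simp add: c'_def)
    show "card {w \<in> verts H. c' w = j} \<le> 1" if "k \<le> j" for j
    proof -
      have "{w \<in> verts H. c' w = j} \<subseteq> (if j = k then {u} else {v})"
        using range that by (fastforce simp: c'_def split: if_splits)
      then have "card {w \<in> verts H. c' w = j} \<le> card (if j = k then {u} else {v})"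
        by (intro card_mono) auto
      then show ?thesis by (simp split: if_splits)
    qed
    fix w w' assume edge: "{w, w'} \<in> edges H"
    have w: "w \<in> verts H" "w' \<in> verts H" "w \<noteq> w'"
      using edge_vertsD[OF assms(1) edge] by auto
    show "c' w \<noteq> c' w'"
      using proper[OF edge] range[OF w(1)] range[OF w(2)] w(3) uv(1,2)
      by (auto simp: c'_def doubleton_eq_iff)
    show "c' w' \<noteq> i" if "k \<le> c' w"
    proof (cases "w' \<in> {u, v}")
      case True
      then show ?thesis using assms(4) by (auto simp: c'_def)
    next
      case False
      have "c w = i" using that range[OF w(1)] uv(3,4) by (auto simp: c'_def split: if_splits)
      moreover have "{w, w'} \<noteq> e" using False uv(1) by auto
      ultimately show ?thesis using proper[OF edge] False by (auto simp: c'_def)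
    qed
  qed
qed

section \<open>Dense induced subgraphs of large minimum degree\<close>

lemma min_degree_subset:
  fixes \<beta> :: real
  assumes G: "simple_graph G"
  obtains S where "S \<subseteq> verts G"
    and "2 * card (edges G) - \<beta> * card (verts G) * (real (card (verts G)) + 1)
      \<le> 2 * card (edges (induced_subgraph G S)) - \<beta> * card S * (real (card S) + 1)"
    and "min_degree_at_least (induced_subgraph G S) (\<beta> * card S)"
proof -
  let ?e = "\<lambda>S. card (edges (induced_subgraph G S))"
  define \<Phi> where "\<Phi> S = 2 * ?e S - \<beta> * card S * (real (card S) + 1)" for S
  have fin: "finite (Pow (verts G))" using finite_verts[OF G] by simp
  then obtain S where S: "S \<in> Pow (verts G)" "Max (\<Phi> ` Pow (verts G)) = \<Phi> S"
    using obtains_MAX[of "Pow (verts G)" \<Phi>] by blast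
  have max: "\<Phi> R \<le> \<Phi> S" if "R \<subseteq> verts G" for R
    unfolding S(2)[symmetric] using that fin by (intro Max_ge) auto
  show thesis
  proof (rule that)
    show "S \<subseteq> verts G" using S(1) by simp
    have "edges (induced_subgraph G (verts G)) = edges G"
      using G by (auto simp: simple_graph_def)
    then show "2 * card (edges G) - \<beta> * card (verts G) * (real (card (verts G)) + 1)
        \<le> 2 * ?e S - \<beta> * card S * (real (card S) + 1)"
      using max[of "verts G"] by (simp only: \<Phi>_def subset_refl)
    show "min_degree_at_least (induced_subgraph G S) (\<beta> * card S)"
      unfolding min_degree_at_least_def verts_induced_subgraph
    proof
      fix v assume v: "v \<in> S"
      have GS: "simple_graph (induced_subgraph G S)"
        using G \<open>S \<subseteq> verts G\<close> by (rule simple_graph_induced_subgraph)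
      have "{e \<in> edges (induced_subgraph G S). v \<notin> e} = edges (induced_subgraph G (S - {v}))"
        by auto
      then have "?e S = ?e (S - {v}) + degree (induced_subgraph G S) v"
        using card_edges_eq_add_degree[OF GS, of v] by simp
      moreover have "real (card S) = real (card (S - {v})) + 1"
        using v finite_verts[OF GS] card_Suc_Diff1[of S v] by simp
      moreover have "\<Phi> (S - {v}) \<le> \<Phi> S"
        using \<open>S \<subseteq> verts G\<close> by (intro max) blast
      ultimately show "\<beta> * card S \<le> degree (induced_subgraph G S) v"
        unfolding \<Phi>_def by (simp add: algebra_simps del: edges_induced_subgraph)
    qed
  qed
qed

lemma dense_core:
  fixes \<beta> x y :: real
  assumes G: "simple_graph G" and \<beta>: "0 \<le> \<beta>" "\<beta> \<le> (y - x) * card (verts G)" and x: "0 < x"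
    and dense: "(\<beta> + y) * real (card (verts G)) ^ 2 \<le> 2 * card (edges G)"
  obtains S where "S \<subseteq> verts G" "min_degree_at_least (induced_subgraph G S) (\<beta> * card S)"
    "x * real (card (verts G)) ^ 2 + \<beta> * real (card S) ^ 2 \<le> 2 * card (edges (induced_subgraph G S))"
    "sqrt x * card (verts G) \<le> card S"
proof -
  define n where "n = real (card (verts G))"
  obtain S where S: "S \<subseteq> verts G"
    "2 * card (edges G) - \<beta> * n * (n + 1)
      \<le> 2 * card (edges (induced_subgraph G S)) - \<beta> * card S * (real (card S) + 1)"
    "min_degree_at_least (induced_subgraph G S) (\<beta> * card S)"
    unfolding n_def by (rule min_degree_subset[OF G])
  have "\<beta> * n \<le> (y - x) * n * n"
    using \<beta>(2) unfolding n_def by (rule mult_right_mono) simp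
  moreover have "0 \<le> \<beta> * card S" using \<beta>(1) by simp
  ultimately have core: "x * n\<^sup>2 + \<beta> * (real (card S))\<^sup>2 \<le> 2 * card (edges (induced_subgraph G S))"
    using S(2) dense by (simp add: n_def[symmetric] algebra_simps power2_eq_square)
  moreover have "real (2 * card (edges (induced_subgraph G S))) \<le> real (card S ^ 2)"
    using two_card_edges_le[OF simple_graph_induced_subgraph[OF G S(1)]]
    unfolding verts_induced_subgraph by (rule of_nat_mono)
  moreover have "0 \<le> \<beta> * (real (card S))\<^sup>2" using \<beta>(1) by simp
  ultimately have "(sqrt x * n)\<^sup>2 \<le> (real (card S))\<^sup>2"
    using x by (simp add: power_mult_distrib)
  then have "sqrt x * n \<le> card S"
    by (rule power2_le_imp_le) simp
  with S(1,3) core show thesis unfolding n_def by (rule that)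
qed

lemma eventually_dense_core:
  fixes \<beta> x y :: real
  assumes "0 \<le> \<beta>" "0 < x" "x < y" and P: "\<forall>\<^sub>F G :: 'b graph in large_graphs. P G"
  shows "\<forall>\<^sub>F G :: 'b graph in large_graphs.
    (\<beta> + y) * real (card (verts G)) ^ 2 \<le> 2 * card (edges G) \<longrightarrow>
    (\<exists>S \<subseteq> verts G. P (induced_subgraph G S) \<and>
      min_degree_at_least (induced_subgraph G S) (\<beta> * card S) \<and>
      x * real (card (verts G)) ^ 2 + \<beta> * real (card S) ^ 2
        \<le> 2 * card (edges (induced_subgraph G S)))"
proof -
  obtain m where m: "\<And>G :: 'b graph. simple_graph G \<Longrightarrow> m \<le> card (verts G) \<Longrightarrow> P G"
    using P unfolding eventually_large_graphs by blast
  have "0 < y - x" "0 < sqrt x" using assms(2,3) by simp_all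
  show ?thesis
    using eventually_simple_graph eventually_le_mult_card_verts[OF \<open>0 < y - x\<close>, of \<beta>]
      eventually_le_mult_card_verts[OF \<open>0 < sqrt x\<close>, of m]
  proof eventually_elim
    case (elim G)
    show ?case
    proof
      assume "(\<beta> + y) * (real (card (verts G)))\<^sup>2 \<le> 2 * card (edges G)"
      then obtain S where S: "S \<subseteq> verts G" "min_degree_at_least (induced_subgraph G S) (\<beta> * card S)"
        "x * real (card (verts G)) ^ 2 + \<beta> * real (card S) ^ 2 \<le> 2 * card (edges (induced_subgraph G S))"
        and "sqrt x * card (verts G) \<le> card S"
        by (rule dense_core[OF elim(1) assms(1) elim(2) assms(2)])
      then have "m \<le> card S" using elim(3) by linarith
      then have "P (induced_subgraph G S)"
        using m simple_graph_induced_subgraph[OF elim(1) S(1)] by simp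
      then show "\<exists>S \<subseteq> verts G. P (induced_subgraph G S) \<and>
          min_degree_at_least (induced_subgraph G S) (\<beta> * card S) \<and>
          x * real (card (verts G)) ^ 2 + \<beta> * real (card S) ^ 2
            \<le> 2 * card (edges (induced_subgraph G S))"
        using S by blast
    qed
  qed
qed

lemma mult_reciprocal_add_less_one:
  fixes d :: real and i k :: nat
  assumes "i < k" "0 < d" "real k ^ 2 * d < 1"
  shows "real i * (1 / k + d) < 1"
proof -
  have "real i * (1 / k + d) \<le> (real k - 1) * (1 / k + d)"
    using assms(1,2) by (intro mult_right_mono) auto
  also have "\<dots> = 1 + (real k ^ 2 * d - 1 - k * d) / k"
    using assms(1) by (simp add: field_simps power2_eq_square)
  also have "\<dots> < 1"
  proof -
    have "0 < k * d" using assms(1,2) by simp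
    then have "real k ^ 2 * d - 1 - k * d < 0" using assms(3) by linarith
    then have "(real k ^ 2 * d - 1 - k * d) / k < 0"
      using assms(1) by (simp add: divide_neg_pos)
    then show ?thesis by simp
  qed
  finally show ?thesis .
qed

lemma core_parameters:
  fixes d :: real
  assumes "k \<ge> 2" "0 < d" "d \<le> 1 / 16"
  shows "0 \<le> 1 - (1 / real k + d)" "0 < d - 2 * d\<^sup>2" "d - 2 * d\<^sup>2 < d - d\<^sup>2"
proof -
  have "1 / real k \<le> 1 / 2" using assms(1) by simp
  then show "0 \<le> 1 - (1 / real k + d)" using assms(3) by linarith
  have "d * d \<le> d * (1 / 16)" using assms(2,3) by (intro mult_left_mono) auto
  then show "0 < d - 2 * d\<^sup>2" "d - 2 * d\<^sup>2 < d - d\<^sup>2"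
    using assms(2) by (simp_all add: power2_eq_square)
qed

lemma core_order_bound:
  fixes d n s x E :: real
  assumes d: "0 < d" and s: "0 \<le> s" "s \<le> n"
    and E: "(d - 2 * d\<^sup>2) * n\<^sup>2 + (x - d) * s\<^sup>2 \<le> E" "E \<le> (x + d\<^sup>2) * s\<^sup>2"
  shows "(1 - 3 * d) * n \<le> s"
proof (cases "n = 0")
  case False
  have "(1 + d) * (1 - 3 * d) * n\<^sup>2 \<le> (1 - 2 * d) * n\<^sup>2"
    by (intro mult_right_mono) (auto simp: algebra_simps)
  also have "d * ((1 - 2 * d) * n\<^sup>2) \<le> d * ((1 + d) * s\<^sup>2)"
    using E by (simp add: algebra_simps power2_eq_square)
  then have "(1 - 2 * d) * n\<^sup>2 \<le> (1 + d) * s\<^sup>2" using d by simp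
  also have "(1 + d) * s\<^sup>2 \<le> (1 + d) * (s * n)"
    using d s by (intro mult_left_mono) (auto simp: power2_eq_square mult_left_mono)
  finally have "((1 + d) * n) * ((1 - 3 * d) * n) \<le> ((1 + d) * n) * s"
    by (simp add: algebra_simps power2_eq_square)
  moreover have "0 < (1 + d) * n" using d s False by simp
  ultimately show ?thesis by (simp only: mult_le_cancel_left_pos)
qed (use s in simp)

section \<open>Stability for graphs with a critical edge\<close>

lemma classes_with_edge:
  assumes G: "simple_graph G" and D: "mutually_complete G {..<k} D"
    and xy: "{x, y} \<in> edges G" "\<forall>j<k. x \<notin> D j \<and> y \<notin> D j"
    and joined: "\<forall>j<k. j \<noteq> i \<longrightarrow> complete_between {x, y} (D j) \<subseteq> edges G"
  defines "C \<equiv> D(k := {x}, Suc k := {y})"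
  shows "j < k + 2 \<Longrightarrow> C j \<subseteq> verts G"
    and "a < k + 2 \<Longrightarrow> b < k + 2 \<Longrightarrow> a \<noteq> b \<Longrightarrow> C a \<inter> C b = {}"
    and "b < a \<Longrightarrow> a < k + 2 \<Longrightarrow> (k \<le> a \<Longrightarrow> b \<noteq> i) \<Longrightarrow> complete_between (C a) (C b) \<subseteq> edges G"
proof -
  have xyG: "x \<in> verts G" "y \<in> verts G" "x \<noteq> y"
    using edge_vertsD[OF G xy(1)] by auto
  show "C j \<subseteq> verts G" if "j < k + 2"
    using that xyG mutually_complete_vertsD[OF D, of j] by (auto simp: C_def less_Suc_eq)
  show "C a \<inter> C b = {}" if "a < k + 2" "b < k + 2" "a \<noteq> b"
    using that xy(2) xyG disjoint_family_on_mutually_complete[OF G D]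
    by (auto simp: C_def disjoint_family_on_def less_Suc_eq)
  show "complete_between (C a) (C b) \<subseteq> edges G"
    if "b < a" "a < k + 2" "k \<le> a \<Longrightarrow> b \<noteq> i"
  proof (cases "a < k")
    case True
    then show ?thesis using D that(1) by (simp add: C_def mutually_complete_def)
  next
    case False
    then show ?thesis
      using that xy(1) joined
      by (auto simp: C_def less_Suc_eq complete_between_subset_iff insert_commute)
  qed
qed

locale colour_critical =
  fixes H :: "'a graph" and k :: nat
  assumes simple: "simple_graph H"
    and critical: "\<exists>e. critical_edge H e"
    and chromatic_number: "chromatic_number H = k + 1"
begin

lemma k_pos: "k > 0"
proof (rule ccontr)
  assume "\<not> k > 0"
  then obtain e where e: "e \<in> edges H" "chromatic_number (delete_edges H {e}) = 0"
    using critical chromatic_number by (auto simp: critical_edge_def)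
  then obtain c where "proper_colouring (delete_edges H {e}) 0 c"
    using proper_colouring_chromatic_number[OF simple_graph_delete_edges[OF simple], of "{e}"] by auto
  then show False
    using edgeE[OF simple e(1)] by (auto simp: proper_colouring_def)
qed

lemma card_verts_pos: "card (verts H) > 0"
  using critical edgeE[OF simple] finite_verts[OF simple]
  by (metis card_gt_0_iff critical_edge_def empty_iff)

lemma is_subgraph_if_edge_in_class:
  assumes G: "simple_graph G" and D: "mutually_complete G {..<k} D"
    and card: "\<And>j. j < k \<Longrightarrow> card (verts H) \<le> card (D j)"
    and i: "i < k" and xy: "{x, y} \<in> edges G" "\<And>j. j < k \<Longrightarrow> x \<notin> D j \<and> y \<notin> D j"
    and joined: "\<And>j. j < k \<Longrightarrow> j \<noteq> i \<Longrightarrow> complete_between {x, y} (D j) \<subseteq> edges G"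
  shows "is_subgraph H G"
proof -
  obtain e where e: "critical_edge H e" using critical by blast
  obtain c where range: "\<And>w. w \<in> verts H \<Longrightarrow> c w < k + 2"
    and singleton: "\<And>j. k \<le> j \<Longrightarrow> card {w \<in> verts H. c w = j} \<le> 1"
    and proper: "\<And>w w'. {w, w'} \<in> edges H \<Longrightarrow> c w \<noteq> c w'"
    and not_i: "\<And>w w'. {w, w'} \<in> edges H \<Longrightarrow> k \<le> c w \<Longrightarrow> c w' \<noteq> i"
    by (rule critical_edge_split_colouring[OF simple e chromatic_number i]) blast
  define C where "C = D(k := {x}, Suc k := {y})"
  have "\<forall>j<k. x \<notin> D j \<and> y \<notin> D j"
    and "\<forall>j<k. j \<noteq> i \<longrightarrow> complete_between {x, y} (D j) \<subseteq> edges G"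
    using xy(2) joined by blast+
  note C = classes_with_edge[OF G D xy(1) this, folded C_def]
  show ?thesis
  proof (rule is_subgraph_if_classes_joined[where c = c and D = C, OF simple G])
    show "C (c w) \<subseteq> verts G" if "w \<in> verts H" for w
      by (rule C(1)[OF range[OF that]])
    show "C (c w) \<inter> C (c w') = {}" if "w \<in> verts H" "w' \<in> verts H" "c w \<noteq> c w'" for w w'
      by (rule C(2)[OF range[OF that(1)] range[OF that(2)] that(3)])
    show "card {w' \<in> verts H. c w' = c w} \<le> card (C (c w))" if "w \<in> verts H" for w
    proof (cases "c w < k")
      case True
      have "card {w' \<in> verts H. c w' = c w} \<le> card (verts H)"
        by (rule card_mono[OF finite_verts[OF simple]]) auto
      then show ?thesis using card[OF True] True by (simp add: C_def)
    next
      case False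
      then have "card (C (c w)) = 1" using range[OF that] by (auto simp: C_def less_Suc_eq)
      then show ?thesis using False singleton[of "c w"] by simp
    qed
    show "complete_between (C (c w)) (C (c w')) \<subseteq> edges G" if edge: "{w, w'} \<in> edges H" for w w'
    proof -
      have "w \<in> verts H" "w' \<in> verts H" "{w', w} \<in> edges H"
        using edge_vertsD[OF simple edge] edge by (auto simp: insert_commute)
      then show ?thesis
        using C(3)[of "c w'" "c w"] C(3)[of "c w" "c w'"] proper[OF edge] range not_i edge
        by (cases "c w < c w'") (auto simp: complete_between_commute)
    qed
  qed
qed

context
  fixes G :: "'b graph" and D :: "nat \<Rightarrow> 'b set"
  assumes G: "simple_graph G" and free: "free_of H G" and D: "mutually_complete G {..<k} D"
begin

lemma few_neighbours_in_some_class: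
  "\<exists>i<k. card (neighbours G v \<inter> D i) \<le> card (verts H)"
proof (rule ccontr)
  assume "\<not> ?thesis"
  then have many: "card (verts H) < card (neighbours G v \<inter> D i)" if "i < k" for i
    using that by (simp add: not_le)
  then have "neighbours G v \<inter> D 0 \<noteq> {}"
    using k_pos by fastforce
  then obtain y where y: "{v, y} \<in> edges G" "y \<in> D 0" by auto
  define C where "C i = neighbours G v \<inter> D i - {y}" for i
  have "is_subgraph H G"
  proof (rule is_subgraph_if_edge_in_class[OF G _ _ k_pos y(1), of C])
    show "mutually_complete G {..<k} C"
      by (rule mutually_complete_mono[OF D]) (auto simp: C_def)
    show "card (verts H) \<le> card (C j)" if "j < k" for j
      using many[OF that] diff_card_le_card_Diff[of "{y}" "neighbours G v \<inter> D j"]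
      by (simp add: C_def)
    show "v \<notin> C j \<and> y \<notin> C j" for j
      using edge_vertsD[OF G, of v v] by (auto simp: C_def)
    show "complete_between {v, y} (C j) \<subseteq> edges G" if "j < k" "j \<noteq> 0" for j
      using mutually_complete_edgeD[OF D, of 0 j y] y(2) k_pos that
      by (auto simp: complete_between_subset_iff C_def)
  qed
  then show False using free by (simp add: free_of_def)
qed

lemma no_edge_if_many_common_neighbours:
  assumes i: "i < k" "card (verts H) + 2 \<le> card (D i)"
    and common: "\<And>j. j < k \<Longrightarrow> j \<noteq> i \<Longrightarrow>
      card (D j) + card (verts H) \<le> card (neighbours G x \<inter> D j) + card (neighbours G y \<inter> D j)"
  shows "{x, y} \<notin> edges G"
proof
  assume xy: "{x, y} \<in> edges G"
  define C where "C j = (if j = i then D j - {x, y} else neighbours G x \<inter> neighbours G y \<inter> D j)" for j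
  have "is_subgraph H G"
  proof (rule is_subgraph_if_edge_in_class[OF G _ _ i(1) xy, of C])
    show "mutually_complete G {..<k} C"
      by (rule mutually_complete_mono[OF D]) (auto simp: C_def)
    show "card (verts H) \<le> card (C j)" if j: "j < k" for j
    proof (cases "j = i")
      case True
      have "card (D i) - card {x, y} \<le> card (D i - {x, y})"
        by (rule diff_card_le_card_Diff) simp
      moreover have "card {x, y} \<le> 2" by (simp add: card_insert_if)
      ultimately show ?thesis using True i(2) by (simp add: C_def)
    next
      case False
      let ?X = "neighbours G x \<inter> D j" and ?Y = "neighbours G y \<inter> D j"
      have fin: "finite (D j)"
        using mutually_complete_vertsD[OF D] j finite_verts[OF G] finite_subset by blast
      have "card ?X + card ?Y = card (?X \<union> ?Y) + card (?X \<inter> ?Y)"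
        using fin by (intro card_Un_Int) auto
      moreover have "card (?X \<union> ?Y) \<le> card (D j)"
        using fin by (intro card_mono) auto
      moreover have "?X \<inter> ?Y = C j" using False by (auto simp: C_def)
      then have "card (?X \<inter> ?Y) = card (C j)" by (rule arg_cong)
      ultimately show ?thesis using common[OF j False] by linarith
    qed
    show "x \<notin> C j \<and> y \<notin> C j" for j
      using edge_vertsD[OF G, of x x] edge_vertsD[OF G, of y y] by (auto simp: C_def)
    show "complete_between {x, y} (C j) \<subseteq> edges G" if "j \<noteq> i" for j
      using that by (auto simp: complete_between_subset_iff C_def)
  qed
  then show False using free by (simp add: free_of_def)
qed

end

lemma eventually_not_min_degree_at_least:
  fixes \<theta> :: real
  assumes "k * \<theta> < 1"
  shows "\<forall>\<^sub>F G :: 'b graph in large_graphs.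
    free_of H G \<longrightarrow> \<not> min_degree_at_least G ((1 - \<theta>) * card (verts G))"
proof -
  have "real i * \<theta> < 1" if "i < Suc k" for i
  proof (cases "\<theta> \<le> 0")
    case True
    then have "real i * \<theta> \<le> 0" by (simp add: mult_nonneg_nonpos)
    then show ?thesis by simp
  next
    case False
    then have "real i * \<theta> \<le> k * \<theta>" using that by (intro mult_right_mono) auto
    then show ?thesis using assms by simp
  qed
  then have "\<forall>\<^sub>F G :: 'b graph in large_graphs. min_degree_at_least G ((1 - \<theta>) * card (verts G)) \<longrightarrow>
      (\<exists>D. blown_up_clique G (Suc k) (Suc (card (verts H))) D)"
    by (rule erdos_stone_min_degree)
  then show ?thesis
    using eventually_simple_graph
  proof eventually_elim
    case (elim G)
    show ?case
    proof (intro impI notI)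
      assume free: "free_of H G" and "min_degree_at_least G ((1 - \<theta>) * card (verts G))"
      then obtain D where "blown_up_clique G (Suc k) (Suc (card (verts H))) D"
        using elim(1) by blast
      then have D: "mutually_complete G {..<Suc k} D"
        and card: "\<And>i. i < Suc k \<Longrightarrow> card (D i) = Suc (card (verts H))"
        by (auto simp: blown_up_clique_def)
      obtain v where v: "v \<in> D k" using card[of k] by fastforce
      have "mutually_complete G {..<k} D"
        using D by (auto simp: mutually_complete_def)
      from few_neighbours_in_some_class[OF elim(2) free this]
      obtain i where "i < k" "card (neighbours G v \<inter> D i) \<le> card (verts H)" by blast
      moreover have "neighbours G v \<inter> D i = D i" if "i < k" for i
        using mutually_complete_edgeD[OF D, of k i v] v that by auto
      ultimately show False using card[of i] by simp
    qed
  qed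
qed

lemma eventually_card_edges_le:
  fixes \<epsilon> :: real
  assumes \<epsilon>: "\<epsilon> > 0"
  shows "\<forall>\<^sub>F G :: 'b graph in large_graphs.
    free_of H G \<longrightarrow> 2 * card (edges G) \<le> (1 - 1 / k + \<epsilon>) * real (card (verts G)) ^ 2"
proof -
  define \<beta> where "\<beta> = 1 - 1 / k + \<epsilon> / 2"
  have "0 \<le> \<beta>" using k_pos \<epsilon> by (simp add: \<beta>_def)
  have "k * (1 - \<beta>) < 1" using k_pos \<epsilon> by (simp add: \<beta>_def field_simps)
  from eventually_not_min_degree_at_least[OF this]
  have sparse: "\<forall>\<^sub>F G :: 'b graph in large_graphs.
      free_of H G \<longrightarrow> \<not> min_degree_at_least G (\<beta> * card (verts G))"
    by simp
  have "0 < \<epsilon> / 4" "\<epsilon> / 4 < \<epsilon> / 2" using \<epsilon> by simp_all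
  from eventually_dense_core[OF \<open>0 \<le> \<beta>\<close> this sparse]
  show ?thesis
  proof eventually_elim
    case (elim G)
    have density: "\<beta> + \<epsilon> / 2 = 1 - 1 / k + \<epsilon>" by (simp add: \<beta>_def)
    show ?case
    proof (intro impI, rule ccontr)
      assume free: "free_of H G"
        and "\<not> 2 * card (edges G) \<le> (1 - 1 / k + \<epsilon>) * (real (card (verts G)))\<^sup>2"
      then obtain S where "S \<subseteq> verts G" "\<not> free_of H (induced_subgraph G S)"
        using elim unfolding density by fastforce
      then show False using free_of_induced_subgraph[OF free] by blast
    qed
  qed
qed

definition atypical :: "'b graph \<Rightarrow> nat \<Rightarrow> (nat \<Rightarrow> 'b set) \<Rightarrow> 'b set" where
  "atypical G t D =
    {v \<in> verts G. card (neighbours G v \<inter> (\<Union>i<k. D i)) + real t / 8 < (real k - 1) * t}"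

context
  fixes G :: "'b graph" and t :: nat and D :: "nat \<Rightarrow> 'b set"
  assumes G: "simple_graph G" and free: "free_of H G" and D: "blown_up_clique G k t D"
begin

lemma card_atypical_le:
  fixes d :: real
  assumes deg: "min_degree_at_least G ((1 - (1 / k + d)) * card (verts G))"
    and t: "t > 0" "card (verts H) \<le> d * t"
  shows "card (atypical G t D) \<le> 8 * (real k + 1) * d * card (verts G)"
proof -
  define h where "h = card (verts H)"
  define N where "N v = card (neighbours G v \<inter> (\<Union>i<k. D i))" for v
  define X where "X = atypical G t D"
  define n where "n = real (card (verts G))"
  have "(\<Sum>v\<in>verts G. real (N v)) + card X * (t / 8 + h) \<le> n * ((real k - 1) * t + h)"
    unfolding n_def
  proof (rule sum_add_card_mult_le[OF finite_verts[OF G]])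
    fix v
    obtain i where "i < k" "card (neighbours G v \<inter> D i) \<le> h"
      using few_neighbours_in_some_class[OF G free] D
      unfolding blown_up_clique_def h_def by blast
    then have "N v + t \<le> k * t + h"
      using card_neighbours_blown_up_clique_le[OF G D, of "{i}" v] by (simp add: N_def)
    then have "real (N v + t) \<le> real (k * t + h)" by (rule of_nat_mono)
    then show "real (N v) \<le> (real k - 1) * t + h" by (simp add: algebra_simps)
  qed (auto simp: X_def atypical_def N_def)
  moreover have "k * t * ((1 - (1 / k + d)) * n) \<le> (\<Sum>v\<in>verts G. real (N v))"
    using sum_card_neighbours_blown_up_clique_ge[OF G D deg] by (simp add: N_def n_def)
  moreover have "k * t * ((1 - (1 / k + d)) * n) = n * ((real k - 1) * t - k * d * t)"
    using k_pos by (simp add: field_simps)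
  ultimately have "card X * (t / 8 + h) \<le> n * (h + k * d * t)"
    by (simp add: algebra_simps)
  moreover have "card X * (t / 8) \<le> card X * (real t / 8 + h)"
    by (intro mult_left_mono) auto
  moreover have "n * (h + k * d * t) \<le> n * (d * t + k * d * t)"
    using t(2) by (intro mult_left_mono) (auto simp: h_def n_def)
  ultimately have "card X * (t / 8) \<le> n * (d * t + k * d * t)" by linarith
  then have "t * real (card X) \<le> t * (8 * (real k + 1) * d * n)"
    by (simp add: algebra_simps)
  then show ?thesis
    using t(1) by (simp add: mult_le_cancel_left X_def n_def)
qed

lemma many_neighbours_if_typical:
  assumes "v \<in> verts G - atypical G t D" "i < k" "card (neighbours G v \<inter> D i) \<le> card (verts H)"
    and "j < k" "j \<noteq> i"
  shows "7 / 8 * t - card (verts H) \<le> card (neighbours G v \<inter> D j)"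
proof -
  have "card (neighbours G v \<inter> (\<Union>i<k. D i)) + 2 * t
      \<le> k * t + card (verts H) + card (neighbours G v \<inter> D j)"
    using card_neighbours_blown_up_clique_le[OF G D, of "{i, j}" v] assms by simp
  then have "real (card (neighbours G v \<inter> (\<Union>i<k. D i)) + 2 * t)
      \<le> real (k * t + card (verts H) + card (neighbours G v \<inter> D j))"
    by (rule of_nat_mono)
  moreover have "(real k - 1) * t \<le> card (neighbours G v \<inter> (\<Union>i<k. D i)) + real t / 8"
    using assms(1) unfolding atypical_def by (auto simp: not_less)
  ultimately show ?thesis by (simp add: algebra_simps)
qed

lemma partition_with_inner_edges_atypical:
  assumes t: "4 * card (verts H) + 8 \<le> t"
  obtains p where "\<And>v. p v < k"
    "\<And>e. e \<in> edges (inner_graph G p) \<Longrightarrow> e \<inter> atypical G t D \<noteq> {}"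
proof -
  have joined: "mutually_complete G {..<k} D" and card: "\<And>i. i < k \<Longrightarrow> card (D i) = t"
    using D by (auto simp: blown_up_clique_def)
  obtain p where p: "\<And>v. p v < k" "\<And>v. card (neighbours G v \<inter> D (p v)) \<le> card (verts H)"
    using few_neighbours_in_some_class[OF G free joined] by metis
  have "e \<inter> atypical G t D \<noteq> {}" if inner: "e \<in> edges (inner_graph G p)" for e
  proof
    assume "e \<inter> atypical G t D = {}"
    moreover obtain x y where "e = {x, y}" "x \<in> verts G" "y \<in> verts G"
      using edgeE[OF simple_graph_inner_graph[OF G] inner] by (metis verts_inner_graph)
    ultimately have x: "x \<in> verts G - atypical G t D" and y: "y \<in> verts G - atypical G t D"
      and xy: "{x, y} \<in> edges G" "p x = p y"
      using inner edge_inner_graph_iff[OF G] by auto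
    have "{x, y} \<notin> edges G"
    proof (rule no_edge_if_many_common_neighbours[OF G free joined p(1)[of x]])
      show "card (verts H) + 2 \<le> card (D (p x))"
        using t p(1) by (simp add: card)
      fix j assume j: "j < k" "j \<noteq> p x"
      then have "7 / 8 * t - card (verts H) \<le> card (neighbours G x \<inter> D j)"
        and "7 / 8 * t - card (verts H) \<le> card (neighbours G y \<inter> D j)"
        using many_neighbours_if_typical[OF x p, of j] many_neighbours_if_typical[OF y p, of j] xy(2)
        by simp_all
      then show "card (D j) + card (verts H) \<le> card (neighbours G x \<inter> D j) + card (neighbours G y \<inter> D j)"
        using t card[OF j(1)] by linarith
    qed
    then show False using xy(1) by simp
  qed
  then show thesis by (rule that[OF p(1)])
qed

end

lemma almost_k_partite_if_core:
  fixes d :: real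
  assumes G: "simple_graph G" and free: "free_of H G" and d: "0 \<le> d"
    and t: "4 * card (verts H) + 8 \<le> t" "card (verts H) \<le> d * t"
    and S: "S \<subseteq> verts G" "(1 - 3 * d) * card (verts G) \<le> card S"
    and deg: "min_degree_at_least (induced_subgraph G S) ((1 - (1 / k + d)) * card S)"
    and D: "blown_up_clique (induced_subgraph G S) k t D"
  shows "almost_k_partite k G (11 * (real k + 1) * d * real (card (verts G)) ^ 2)"
proof -
  define X where "X = atypical (induced_subgraph G S) t D"
  define n where "n = real (card (verts G))"
  have GS: "simple_graph (induced_subgraph G S)" "free_of H (induced_subgraph G S)"
    using simple_graph_induced_subgraph[OF G S(1)] free_of_induced_subgraph[OF free S(1)] .
  obtain p where p: "\<And>v. p v < k"
    "\<And>e. e \<in> edges (inner_graph (induced_subgraph G S) p) \<Longrightarrow> e \<inter> X \<noteq> {}"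
    unfolding X_def by (rule partition_with_inner_edges_atypical[OF GS D t(1)]) blast
  have "card (edges (inner_graph G p)) \<le> (card X + card (verts G - S)) * card (verts G)"
    using p(2) by (intro card_inner_edges_le_if_cover_induced[OF G S(1)]) (auto simp: X_def atypical_def)
  then have inner: "real (card (edges (inner_graph G p))) \<le> (real (card X) + real (card (verts G - S))) * n"
    by (simp add: n_def flip: of_nat_add of_nat_mult)
  have fin: "finite (verts G)" "finite S"
    using finite_verts[OF G] finite_verts[OF GS(1)] by auto
  then have "card S + card (verts G - S) = card (verts G)"
    using S(1) by (simp add: card_Diff_subset card_mono)
  then have "real (card S) + card (verts G - S) = n" by (simp add: n_def flip: of_nat_add)
  then have "card (verts G - S) \<le> 3 * d * n" using S(2) by (simp add: n_def algebra_simps)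
  moreover have "card X \<le> 8 * (real k + 1) * d * n"
  proof -
    have "card X \<le> 8 * (real k + 1) * d * card S"
      using card_atypical_le[OF GS D _ _ t(2)] deg t(1) by (simp add: X_def)
    also have "\<dots> \<le> 8 * (real k + 1) * d * n"
      using S(1) fin d by (intro mult_left_mono) (auto simp: n_def card_mono)
    finally show ?thesis .
  qed
  moreover have "3 * d * n \<le> 3 * (real k + 1) * d * n"
    using d by (intro mult_right_mono) (auto simp: n_def)
  ultimately have "real (card X) + card (verts G - S) \<le> 11 * (real k + 1) * d * n"
    by (simp add: algebra_simps)
  then have "(real (card X) + real (card (verts G - S))) * n \<le> 11 * (real k + 1) * d * n * n"
    by (rule mult_right_mono) (simp add: n_def)
  then have "card (edges (inner_graph G p)) \<le> 11 * (real k + 1) * d * n\<^sup>2"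
    using inner by (simp add: power2_eq_square mult.assoc)
  then show ?thesis
    using p(1) by (auto simp: almost_k_partite_def n_def)
qed

lemma eventually_almost_k_partite:
  fixes d :: real
  assumes k: "k \<ge> 2" and d: "0 < d" "d \<le> 1 / 16" "real k ^ 2 * d < 1"
  shows "\<forall>\<^sub>F G :: 'b graph in large_graphs. free_of H G \<longrightarrow>
    (1 - 1 / k - d\<^sup>2) * real (card (verts G)) ^ 2 \<le> 2 * card (edges G) \<longrightarrow>
    almost_k_partite k G (11 * (real k + 1) * d * real (card (verts G)) ^ 2)"
proof -
  define \<beta> where "\<beta> = 1 - (1 / k + d)"
  obtain t :: nat where "max (card (verts H) / d) (4 * card (verts H) + 8) \<le> t"
    using real_arch_simple by blast
  then have t: "4 * card (verts H) + 8 \<le> t" "card (verts H) \<le> d * t"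
    using d(1) by (auto simp: field_simps)
  have "real i * (1 / k + d) < 1" if "i < k" for i
    using that d(1,3) by (rule mult_reciprocal_add_less_one)
  then have "\<forall>\<^sub>F G :: 'b graph in large_graphs.
      min_degree_at_least G (\<beta> * card (verts G)) \<longrightarrow> (\<exists>D. blown_up_clique G k t D)"
    unfolding \<beta>_def by (rule erdos_stone_min_degree)
  moreover have "\<forall>\<^sub>F G :: 'b graph in large_graphs.
      free_of H G \<longrightarrow> 2 * card (edges G) \<le> (1 - 1 / k + d\<^sup>2) * real (card (verts G)) ^ 2"
    using d(1) by (intro eventually_card_edges_le) simp
  ultimately have "\<forall>\<^sub>F G :: 'b graph in large_graphs.
      (min_degree_at_least G (\<beta> * card (verts G)) \<longrightarrow> (\<exists>D. blown_up_clique G k t D)) \<and>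
      (free_of H G \<longrightarrow> 2 * card (edges G) \<le> (1 - 1 / k + d\<^sup>2) * real (card (verts G)) ^ 2)"
    by (rule eventually_conj)
  from eventually_dense_core[OF core_parameters[OF k d(1,2), folded \<beta>_def] this] eventually_simple_graph
  show ?thesis
  proof eventually_elim
    case (elim G)
    have density: "\<beta> + (d - d\<^sup>2) = 1 - 1 / k - d\<^sup>2" "\<beta> = 1 - 1 / k - d" by (simp_all add: \<beta>_def)
    show ?case
    proof (intro impI)
      assume free: "free_of H G"
        and "(1 - 1 / k - d\<^sup>2) * (real (card (verts G)))\<^sup>2 \<le> 2 * card (edges G)"
      then obtain S D where S: "S \<subseteq> verts G"
        "min_degree_at_least (induced_subgraph G S) (\<beta> * card S)" "blown_up_clique (induced_subgraph G S) k t D"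
        and edges: "(d - 2 * d\<^sup>2) * real (card (verts G)) ^ 2 + \<beta> * real (card S) ^ 2
            \<le> 2 * card (edges (induced_subgraph G S))"
          "2 * card (edges (induced_subgraph G S)) \<le> (1 - 1 / k + d\<^sup>2) * real (card S) ^ 2"
        using elim(1) free_of_induced_subgraph[OF free] unfolding density(1) verts_induced_subgraph by blast
      have "(1 - 3 * d) * card (verts G) \<le> card S"
        using S(1) finite_verts[OF elim(2)] edges[unfolded density(2)]
        by (intro core_order_bound[OF d(1)]) (auto intro: card_mono)
      then show "almost_k_partite k G (11 * (real k + 1) * d * (real (card (verts G)))\<^sup>2)"
        using S d(1) by (intro almost_k_partite_if_core[OF elim(2) free _ t]) (auto simp: \<beta>_def)
    qed
  qed
qed

theorem stability:
  fixes \<epsilon> :: real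
  assumes k: "k \<ge> 2" and \<epsilon>: "\<epsilon> > 0"
  obtains \<delta> where "\<delta> > 0"
    "\<forall>\<^sub>F G :: 'b graph in large_graphs. free_of H G \<longrightarrow>
      (1 - 1 / k - \<delta>) * real (card (verts G)) ^ 2 \<le> 2 * card (edges G) \<longrightarrow>
      almost_k_partite k G (\<epsilon> * real (card (verts G)) ^ 2)"
proof -
  define d where "d = min (\<epsilon> / (11 * (real k + 1))) (1 / (4 * real k ^ 2))"
  have "d \<le> \<epsilon> / (11 * (real k + 1))" "d \<le> 1 / (4 * real k ^ 2)" "d > 0"
    using \<epsilon> k by (simp_all add: d_def)
  moreover have "0 < 11 * (real k + 1)" "0 < 4 * real k ^ 2" using k by simp_all
  ultimately have d: "d > 0" "11 * (real k + 1) * d \<le> \<epsilon>" "4 * real k ^ 2 * d \<le> 1"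
    by (simp_all only: pos_le_divide_eq mult.commute[of d])
  have "4 * d \<le> real k ^ 2 * d"
    using k d(1) power_mono[of 2 "real k" 2] by (intro mult_right_mono) auto
  then have d_small: "d \<le> 1 / 16" "real k ^ 2 * d < 1" using d(3) by linarith+
  show thesis
  proof (rule that)
    show "d\<^sup>2 > 0" using d(1) by simp
    show "\<forall>\<^sub>F G :: 'b graph in large_graphs. free_of H G \<longrightarrow>
        (1 - 1 / k - d\<^sup>2) * real (card (verts G)) ^ 2 \<le> 2 * card (edges G) \<longrightarrow>
        almost_k_partite k G (\<epsilon> * real (card (verts G)) ^ 2)"
      using eventually_almost_k_partite[OF k d(1) d_small]
    proof eventually_elim
      case (elim G)
      have "11 * (real k + 1) * d * (real (card (verts G)))\<^sup>2 \<le> \<epsilon> * (real (card (verts G)))\<^sup>2"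
        using d(2) by (rule mult_right_mono) simp
      then show ?case using elim almost_k_partite_mono by blast
    qed
  qed
qed

end

section \<open>Minimal inner edges and greedy embedding\<close>

context
  fixes G :: "'b graph"
  assumes G: "simple_graph G"
begin

lemma almost_k_partite_locally_optimal:
  assumes "almost_k_partite k G x"
  obtains p where "\<And>v. p v < k" "real (card (edges (inner_graph G p))) \<le> x"
    and "\<And>v i. i < k \<Longrightarrow> degree (inner_graph G p) v \<le> card (colour_class (neighbours G v) p i)"
proof -
  obtain q where q: "\<forall>v. q v < k" "real (card (edges (inner_graph G q))) \<le> x"
    using assms by (auto simp: almost_k_partite_def)
  then obtain p where p: "\<And>v. p v < k"
    and min: "\<And>q. \<forall>v. q v < k \<Longrightarrow> card (edges (inner_graph G p)) \<le> card (edges (inner_graph G q))"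
    using ex_has_least_nat[of "\<lambda>p. \<forall>v. p v < k" q "\<lambda>p. card (edges (inner_graph G p))"] by blast
  have "degree (inner_graph G p) v \<le> card (colour_class (neighbours G v) p i)" if i: "i < k" for v i
  proof -
    define q where "q = p(v := i)"
    have "{e \<in> edges (inner_graph G q). v \<notin> e} = {e \<in> edges (inner_graph G p). v \<notin> e}" (is "?Q = ?P")
    proof -
      have "e \<in> ?Q \<longleftrightarrow> e \<in> ?P" for e
      proof (cases "e \<in> edges G")
        case True
        then obtain x y where "e = {x, y}" using edgeE[OF G] by blast
        then show ?thesis by (auto simp: edge_inner_graph_iff[OF G] q_def)
      qed (simp add: inner_graph_def)
      then show ?thesis by blast
    qed
    moreover have "neighbours (inner_graph G q) v = colour_class (neighbours G v) p i"
      using edge_vertsD[OF G, of v v]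
      by (auto simp: edge_inner_graph_iff[OF G] q_def split: if_splits)
    then have "degree (inner_graph G q) v = card (colour_class (neighbours G v) p i)"
      by (simp only: degree_def)
    moreover have "card (edges (inner_graph G p)) \<le> card (edges (inner_graph G q))"
      using i p by (intro min) (simp add: q_def)
    ultimately show ?thesis
      using card_edges_eq_add_degree[OF simple_graph_inner_graph[OF G], of _ v] by simp
  qed
  moreover have "real (card (edges (inner_graph G p))) \<le> x" using min[OF q(1)] q(2) by linarith
  ultimately show thesis using that p by blast
qed

lemma colour_class_subset_joined:
  fixes g :: real
  assumes Q: "finite Q" "Q \<subseteq> verts G" "\<And>v. v \<in> Q \<Longrightarrow> degree (missing_graph G p) v \<le> g"
    and Z: "finite Z"
    and size: "card Q * g + card Z + t \<le> card (colour_class (verts G) p i)"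
  obtains W where "W \<subseteq> colour_class (verts G) p i - Z" "card W = t"
    "\<And>w q. w \<in> W \<Longrightarrow> q \<in> Q \<Longrightarrow> p q \<noteq> i \<Longrightarrow> {w, q} \<in> edges G"
proof -
  define U where "U = (\<Union>q\<in>Q. neighbours (missing_graph G p) q)"
  define C where "C = colour_class (verts G) p i - (Z \<union> U)"
  have "finite U"
    unfolding U_def using Q(1) finite_neighbours[OF simple_graph_missing_graph[OF G]] by blast
  have "card U \<le> (\<Sum>q\<in>Q. degree (missing_graph G p) q)"
    unfolding U_def degree_def by (rule card_UN_le[OF Q(1)])
  then have "real (card U) \<le> (\<Sum>q\<in>Q. real (degree (missing_graph G p) q))"
    by (simp flip: of_nat_sum)
  also have "\<dots> \<le> card Q * g"
    using Q(3) by (rule sum_bounded_above)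
  finally have U: "card U \<le> card Q * g" .
  have "card (colour_class (verts G) p i) - card (Z \<union> U) \<le> card C"
    unfolding C_def using Z \<open>finite U\<close> by (intro diff_card_le_card_Diff) simp
  then have "card (colour_class (verts G) p i) \<le> card Z + card U + card C"
    using card_Un_le[of Z U] by linarith
  then have "t \<le> card C" using U size by linarith
  then obtain W where W: "W \<subseteq> C" "card W = t"
    by (meson obtain_subset_with_card_n)
  show thesis
  proof (rule that[of W])
    fix w q assume wq: "w \<in> W" "q \<in> Q" "p q \<noteq> i"
    then have "w \<in> verts G" "p w = i" "w \<notin> U" using W(1) by (auto simp: C_def)
    moreover then have "w \<notin> neighbours (missing_graph G p) q"
      using wq(2) unfolding U_def by blast
    ultimately show "{w, q} \<in> edges G"
      using wq(2,3) Q(2) by (auto simp: insert_commute)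
  qed (use W in \<open>auto simp: C_def\<close>)
qed

end

definition aligned_clique ::
  "'a graph \<Rightarrow> ('a \<Rightarrow> nat) \<Rightarrow> 'a set \<Rightarrow> 'a set \<Rightarrow> nat \<Rightarrow> nat \<Rightarrow> (nat \<Rightarrow> 'a set) \<Rightarrow> bool" where
  "aligned_clique G p S Z r t D \<longleftrightarrow> blown_up_clique G r t D \<and>
     (\<forall>i<r. D i \<subseteq> colour_class (verts G) p i - Z \<and>
       complete_between (D i) {s \<in> S. p s \<noteq> i} \<subseteq> edges G)"

lemma aligned_clique_blown_up_clique: "aligned_clique G p S Z r t D \<Longrightarrow> blown_up_clique G r t D"
  by (simp add: aligned_clique_def)

lemma aligned_clique_subset:
  "aligned_clique G p S Z r t D \<Longrightarrow> i < r \<Longrightarrow> D i \<subseteq> colour_class (verts G) p i - Z"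
  by (simp add: aligned_clique_def)

lemma aligned_clique_edgeD:
  "aligned_clique G p S Z r t D \<Longrightarrow> i < r \<Longrightarrow> x \<in> D i \<Longrightarrow> s \<in> S \<Longrightarrow> p s \<noteq> i
    \<Longrightarrow> {x, s} \<in> edges G"
  by (simp add: aligned_clique_def complete_between_subset_iff)

lemma aligned_clique_Suc:
  fixes g :: real
  assumes G: "simple_graph G" and S: "S \<subseteq> verts G" and Z: "finite Z"
    and few: "\<And>v. v \<in> S \<union> (verts G - Z) \<Longrightarrow> degree (missing_graph G p) v \<le> g" and g: "0 \<le> g"
    and size: "(card S + r * t) * g + card Z + t \<le> card (colour_class (verts G) p r)"
    and D: "aligned_clique G p S Z r t D"
  obtains D' where "aligned_clique G p S Z (Suc r) t D'"
proof -
  define Q where "Q = S \<union> (\<Union>i<r. D i)"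
  have joined: "mutually_complete G {..<r} D" and card: "\<And>i. i < r \<Longrightarrow> card (D i) = t"
    using aligned_clique_blown_up_clique[OF D] by (auto simp: blown_up_clique_def)
  have Q: "Q \<subseteq> S \<union> (verts G - Z)" "Q \<subseteq> verts G"
    using aligned_clique_subset[OF D] S by (auto simp: Q_def)
  have "card Q \<le> card S + card (\<Union>i<r. D i)" unfolding Q_def by (rule card_Un_le)
  also have "card (\<Union>i<r. D i) \<le> (\<Sum>i<r. card (D i))" by (rule card_UN_le) simp
  also have "\<dots> = r * t" using card by simp
  finally have "card Q * g \<le> (card S + r * t) * g"
    using g by (intro mult_right_mono) (simp_all flip: of_nat_add of_nat_mult)
  then have "card Q * g + card Z + t \<le> card (colour_class (verts G) p r)"
    using size by simp
  moreover have "degree (missing_graph G p) v \<le> g" if "v \<in> Q" for v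
    using that Q(1) few by blast
  ultimately obtain W where W: "W \<subseteq> colour_class (verts G) p r - Z" "card W = t"
    and WQ: "\<And>w q. w \<in> W \<Longrightarrow> q \<in> Q \<Longrightarrow> p q \<noteq> r \<Longrightarrow> {w, q} \<in> edges G"
    using colour_class_subset_joined[OF G finite_subset[OF Q(2) finite_verts[OF G]] Q(2) _ Z, of p g t r]
    by blast
  have "complete_between W (D i) \<subseteq> edges G" if "i \<in> {..<r}" for i
    unfolding complete_between_subset_iff
  proof (intro ballI)
    fix w x assume "w \<in> W" "x \<in> D i"
    then show "{w, x} \<in> edges G"
      using that aligned_clique_subset[OF D, of i] by (intro WQ) (auto simp: Q_def)
  qed
  then have "mutually_complete G {..<Suc r} (D(r := W))"
    unfolding lessThan_Suc using joined W(1) by (intro mutually_complete_insert) auto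
  moreover have "complete_between W {s \<in> S. p s \<noteq> r} \<subseteq> edges G"
    using WQ by (simp add: complete_between_subset_iff Q_def)
  ultimately have "aligned_clique G p S Z (Suc r) t (D(r := W))"
    using D card W by (auto simp: aligned_clique_def blown_up_clique_def less_Suc_eq)
  then show thesis by (rule that)
qed

lemma aligned_clique_exists:
  fixes g :: real
  assumes "simple_graph G" "S \<subseteq> verts G" "finite Z"
    and "\<And>v. v \<in> S \<union> (verts G - Z) \<Longrightarrow> degree (missing_graph G p) v \<le> g" and g: "0 \<le> g"
    and size: "\<And>i. i < r \<Longrightarrow> (card S + r * t) * g + card Z + t \<le> card (colour_class (verts G) p i)"
  shows "\<exists>D. aligned_clique G p S Z r t D"
proof -
  have "\<exists>D. aligned_clique G p S Z m t D" if "m \<le> r" for m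
    using that
  proof (induction m)
    case 0
    then show ?case by (simp add: aligned_clique_def blown_up_clique_def mutually_complete_def)
  next
    case (Suc m)
    then obtain D where "aligned_clique G p S Z m t D" by auto
    moreover have "(card S + m * t) * g \<le> (card S + r * t) * g"
      using g Suc.prems by (intro mult_right_mono of_nat_mono add_left_mono mult_le_mono1) auto
    then have "(card S + m * t) * g + card Z + t \<le> card (colour_class (verts G) p m)"
      using size[of m] Suc.prems by simp
    ultimately show ?case
      using aligned_clique_Suc[OF assms(1-5)] by metis
  qed
  then show ?thesis by simp
qed

section \<open>Inner edges of a locally optimal partition\<close>

context colour_critical
begin

context
  fixes G :: "'b graph" and p :: "'b \<Rightarrow> nat" and B :: "'b set" and t :: nat and g :: real
  assumes G: "simple_graph G" and free: "free_of H G"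
    and p: "\<And>v. p v < k" and t: "card (verts H) \<le> t"
    and B: "B \<subseteq> verts G" "\<And>v. v \<in> verts G - B \<Longrightarrow> degree (missing_graph G p) v \<le> g" and g: "0 \<le> g"
    and size: "\<And>i. i < k \<Longrightarrow>
      (k * t + k * t) * g + card B + k * t + 1 + t \<le> card (colour_class (verts G) p i)"
begin

lemma aligned_clique_outside:
  assumes S: "S \<subseteq> verts G - B" "card S \<le> k * t" and Z: "finite Z" "card Z \<le> k * t + 1"
  obtains D where "aligned_clique G p S Z k t D"
proof -
  have "\<exists>D. aligned_clique G p S (B \<union> Z) k t D"
  proof (rule aligned_clique_exists[OF G])
    show "finite (B \<union> Z)" "S \<subseteq> verts G"
      using S(1) Z(1) finite_subset[OF B(1) finite_verts[OF G]] by auto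
    show "degree (missing_graph G p) v \<le> g" if "v \<in> S \<union> (verts G - (B \<union> Z))" for v
      using that S(1) B(2) by blast
    fix i assume i: "i < k"
    have "(card S + k * t) * g \<le> (k * t + k * t) * g"
      using S(2) g by (intro mult_right_mono) (simp_all flip: of_nat_add of_nat_mult)
    moreover have "card (B \<union> Z) \<le> card B + k * t + 1"
      using card_Un_le[of B Z] Z(2) by linarith
    then have "real (card (B \<union> Z)) \<le> real (card B + k * t + 1)" by (rule of_nat_mono)
    ultimately show "(card S + k * t) * g + card (B \<union> Z) + t \<le> card (colour_class (verts G) p i)"
      using size[OF i] by simp
  qed (rule g)
  then obtain D where "aligned_clique G p S (B \<union> Z) k t D" by blast
  then have "aligned_clique G p S Z k t D" by (auto simp: aligned_clique_def)
  then show thesis by (rule that)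
qed

lemma inner_edge_meets_exceptional:
  assumes edge: "e \<in> edges (inner_graph G p)" and k: "k \<ge> 2"
  shows "e \<inter> B \<noteq> {}"
proof
  assume disj: "e \<inter> B = {}"
  obtain x y where "e = {x, y}" "x \<in> verts G" "y \<in> verts G"
    using edgeE[OF simple_graph_inner_graph[OF G] edge] by (metis verts_inner_graph)
  with edge disj have xy: "{x, y} \<in> edges G" "p x = p y" "{x, y} \<subseteq> verts G - B"
    by (auto simp: edge_inner_graph_iff[OF G])
  have "card {x, y} \<le> 2" by (simp add: card_insert_if)
  moreover have "2 \<le> k * t" using k t card_verts_pos mult_le_mono[of 2 k 1 t] by simp
  ultimately obtain D where D: "aligned_clique G p {x, y} {x, y} k t D"
    using aligned_clique_outside[OF xy(3), of "{x, y}"] by auto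
  have "is_subgraph H G"
  proof (rule is_subgraph_if_edge_in_class[OF G _ _ p[of x] xy(1)])
    show "mutually_complete G {..<k} D" "\<And>j. j < k \<Longrightarrow> card (verts H) \<le> card (D j)"
      using aligned_clique_blown_up_clique[OF D] t by (auto simp: blown_up_clique_def)
    show "x \<notin> D j \<and> y \<notin> D j" if "j < k" for j
      using aligned_clique_subset[OF D that] by blast
    show "complete_between {x, y} (D j) \<subseteq> edges G" if "j < k" "j \<noteq> p x" for j
      using aligned_clique_edgeD[OF D that(1)] that(2) xy(2)
      by (auto simp: complete_between_subset_iff insert_commute)
  qed
  then show False using free by (simp add: free_of_def)
qed

lemma is_subgraph_mycielskian_if_apex:
  assumes v: "v \<in> verts G" and a: "a \<le> t"
    and W: "\<And>i. i < k \<Longrightarrow> W i \<subseteq> colour_class (neighbours G v) p i - B" "\<And>i. i < k \<Longrightarrow> card (W i) = t"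
  shows "is_subgraph (blown_up_mycielskian k a a 1) G"
proof -
  define S where "S = (\<Union>i<k. W i)"
  have S: "S \<subseteq> verts G - B"
    using W(1) neighbours_subset[OF G, of v] by (fastforce simp: S_def)
  have "card S \<le> (\<Sum>i<k. card (W i))" unfolding S_def by (rule card_UN_le) simp
  then have cardS: "card S \<le> k * t" using W(2) by simp
  moreover have "finite S" using S finite_verts[OF G] by (auto intro: finite_subset)
  ultimately have "finite (insert v S)" "card (insert v S) \<le> k * t + 1"
    by (auto simp: card_insert_if)
  then obtain D where D: "aligned_clique G p S (insert v S) k t D"
    using aligned_clique_outside[OF S cardS, of "insert v S"] by blast
  show ?thesis
  proof (rule is_subgraph_blown_up_mycielskian[OF G, of k D W "{v}"])
    show "mutually_complete G {..<k} D" "\<And>i. i < k \<Longrightarrow> a \<le> card (D i)" "\<And>i. i < k \<Longrightarrow> a \<le> card (W i)"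
      using aligned_clique_blown_up_clique[OF D] a W(2) by (auto simp: blown_up_clique_def)
    show "W i \<subseteq> verts G" "D i \<inter> W i = {}" "{v} \<inter> D i = {}" if "i < k" for i
      using that S aligned_clique_subset[OF D that] by (auto simp: S_def)
    show "disjoint_family_on W {..<k}"
      unfolding disjoint_family_on_def using W(1) by blast
    show "complete_between (D i) (W j) \<subseteq> edges G" if "i < k" "j < k" "i \<noteq> j" for i j
      unfolding complete_between_subset_iff
    proof (intro ballI)
      fix x w assume "x \<in> D i" "w \<in> W j"
      moreover from this have "w \<in> S" "p w \<noteq> i" using that W(1)[of j] by (auto simp: S_def)
      ultimately show "{x, w} \<in> edges G" using aligned_clique_edgeD[OF D that(1)] by blast
    qed
    show "complete_between (W i) {v} \<subseteq> edges G" if "i < k" for i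
      using W(1)[OF that] by (auto simp: complete_between_subset_iff insert_commute)
  qed (use v in auto)
qed

lemma inner_degree_le:
  assumes myc: "is_subgraph H (blown_up_mycielskian k a a 1)" and a: "a \<le> t"
    and opt: "\<And>i. i < k \<Longrightarrow> degree (inner_graph G p) v \<le> card (colour_class (neighbours G v) p i)"
  shows "degree (inner_graph G p) v \<le> card B + t"
proof (rule ccontr)
  assume large: "\<not> ?thesis"
  have "finite B" using B(1) finite_verts[OF G] by (rule finite_subset)
  moreover have "card B + t \<le> card (colour_class (neighbours G v) p i)" if "i < k" for i
    using opt[OF that] large by linarith
  ultimately have "\<exists>W. \<forall>i<k. W i \<subseteq> colour_class (neighbours G v) p i - B \<and> card (W i) = t"
    by (rule exists_subsets_avoiding)
  then obtain W where W: "\<And>i. i < k \<Longrightarrow> W i \<subseteq> colour_class (neighbours G v) p i - B"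
    "\<And>i. i < k \<Longrightarrow> card (W i) = t"
    by blast
  have "neighbours (inner_graph G p) v \<noteq> {}"
    using large by (auto simp: degree_def)
  then have "v \<in> verts G"
    using edge_vertsD[OF G, of v] unfolding neighbours_inner_graph[OF G] by auto
  from is_subgraph_mycielskian_if_apex[OF this a W]
  have "is_subgraph (blown_up_mycielskian k a a 1) G" by blast
  then have "is_subgraph H G" by (rule is_subgraph_trans[OF myc])
  then show False using free by (simp add: free_of_def)
qed

lemma card_inner_edges_le:
  assumes "is_subgraph H (blown_up_mycielskian k a a 1)" "a \<le> t" "k \<ge> 2"
    and "\<And>v i. i < k \<Longrightarrow> degree (inner_graph G p) v \<le> card (colour_class (neighbours G v) p i)"
  shows "card (edges (inner_graph G p)) \<le> card B * (card B + t)"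
proof -
  have "card (edges (inner_graph G p)) \<le> (\<Sum>v\<in>B. degree (inner_graph G p) v)"
    using inner_edge_meets_exceptional assms(3) finite_subset[OF B(1) finite_verts[OF G]]
    by (intro card_edges_le_sum_degree[OF simple_graph_inner_graph[OF G]]) auto
  also have "\<dots> \<le> card B * (card B + t)"
    using inner_degree_le[OF assms(1,2,4)]
      sum_bounded_above[of B "degree (inner_graph G p)" "card B + t"] by simp
  finally show ?thesis .
qed

end

end

section \<open>The number of inner edges\<close>

text \<open>Vertices that each miss at most this proportion of all vertices can be extended greedily:
  \<open>2 k t\<close> of them together miss at most a quarter of a class of size \<open>n / (2 k)\<close>.\<close>

definition missing_ratio :: "nat \<Rightarrow> nat \<Rightarrow> real" where
  "missing_ratio k t = 1 / (16 * real k ^ 2 * t)"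

lemma missing_ratio_pos: "0 < k \<Longrightarrow> 0 < t \<Longrightarrow> 0 < missing_ratio k t"
  by (simp add: missing_ratio_def)

lemma missing_ratio_le:
  assumes "0 < k" "0 < t"
  shows "missing_ratio k t \<le> 1 / k"
proof -
  have "1 * 1 \<le> 16 * real k * t" using assms by (intro mult_mono) auto
  then have "1 / (real k * (16 * real k * t)) \<le> 1 / (real k * 1)"
    using assms by (intro divide_left_mono mult_left_mono) auto
  then show ?thesis by (simp add: missing_ratio_def power2_eq_square algebra_simps)
qed

lemma greedy_room:
  fixes n b q :: real and k t :: nat
  assumes "0 < k" "0 < t" "n / (2 * k) \<le> q" "b \<le> n / (8 * k)" "4 * k * (real (k * t) + t + 1) \<le> n"
  shows "(k * t + k * t) * (missing_ratio k t * n) + b + k * t + 1 + t \<le> q"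
proof -
  have "(k * t + k * t) * (missing_ratio k t * n) = n / (8 * k)"
    using assms(1,2) by (simp add: missing_ratio_def power2_eq_square)
  moreover have "real (k * t) + t + 1 \<le> n / (4 * k)"
    using assms(1,5) by (simp add: field_simps)
  moreover have "n / (8 * k) + n / (8 * k) + n / (4 * k) = n / (2 * k)"
    by (simp add: field_simps)
  ultimately show ?thesis using assms(3,4) by simp
qed

lemma ge_half_average_if_deviation_le:
  fixes k :: nat and n :: real and q :: "nat \<Rightarrow> real"
  assumes "(\<Sum>i<k. (q i - n / k)\<^sup>2) \<le> (n / (2 * k))\<^sup>2" "0 \<le> n" "i < k"
  shows "n / (2 * k) \<le> q i"
proof -
  have "(q i - n / k)\<^sup>2 \<le> (\<Sum>i<k. (q i - n / k)\<^sup>2)"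
    using assms(3) by (intro member_le_sum) auto
  then have "\<bar>q i - n / k\<bar> \<le> n / (2 * k)"
    using assms(1,2) by (intro power2_le_imp_le[of "\<bar>q i - n / k\<bar>"]) auto
  moreover have "n / k = n / (2 * k) + n / (2 * k)" by simp
  ultimately show ?thesis by linarith
qed

lemma inner_edge_count_bound:
  fixes I b f x K :: real and t :: nat
  assumes I: "0 \<le> I" "I \<le> b * (b + t)" and x: "x > 0"
    and b: "b = 0 \<or> 1 \<le> b" "b * x \<le> 2 * f + K + 2 * I" "8 * b \<le> x"
    and large: "8 * t \<le> x" "4 * K \<le> x"
  shows "I \<le> 64 * (real t + 1) * f\<^sup>2 / x\<^sup>2"
proof (cases "b = 0")
  case True
  then show ?thesis using I by simp
next
  case False
  then have b_ge: "1 \<le> b" using b(1) by simp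
  have "b * (b + t) \<le> b * (x / 4)"
    using b_ge b(3) large(1) by (intro mult_left_mono) auto
  moreover have "1 * x \<le> b * x" using b_ge x by (intro mult_right_mono) auto
  ultimately have "b * x \<le> 8 * f" using I(2) b(2) large(2) by (simp add: algebra_simps)
  then have "(b * x)\<^sup>2 \<le> (8 * f)\<^sup>2" using b_ge x by (intro power_mono) auto
  then have square: "b\<^sup>2 \<le> 64 * f\<^sup>2 / x\<^sup>2"
    using x by (simp add: power_mult_distrib pos_le_divide_eq)
  have "real t * 1 \<le> t * b" using b_ge by (intro mult_left_mono) auto
  then have "b * (b + t) \<le> b * ((real t + 1) * b)"
    using b_ge by (intro mult_left_mono) (auto simp: algebra_simps)
  then have "I \<le> (real t + 1) * b\<^sup>2" using I(2) by (simp add: power2_eq_square algebra_simps)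
  also have "\<dots> \<le> (real t + 1) * (64 * f\<^sup>2 / x\<^sup>2)"
    using square by (intro mult_left_mono) auto
  finally show ?thesis by (simp add: algebra_simps)
qed

definition exceptional :: "'a graph \<Rightarrow> ('a \<Rightarrow> nat) \<Rightarrow> real \<Rightarrow> 'a set" where
  "exceptional G p x = {v \<in> verts G. x < degree (missing_graph G p) v}"

lemma card_exceptional_mult_le:
  fixes x :: real
  assumes G: "simple_graph G"
  shows "card (exceptional G p x) * x \<le> 2 * card (edges (missing_graph G p))"
proof -
  let ?d = "degree (missing_graph G p)"
  have "card (exceptional G p x) * x \<le> (\<Sum>v\<in>exceptional G p x. real (?d v))"
    by (intro sum_bounded_below) (auto simp: exceptional_def)
  also have "\<dots> \<le> (\<Sum>v\<in>verts G. real (?d v))"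
    using finite_verts[OF G] by (intro sum_mono2) (auto simp: exceptional_def)
  also have "\<dots> = 2 * card (edges (missing_graph G p))"
    using sum_degree[OF simple_graph_missing_graph[OF G], of p] by (simp flip: of_nat_sum)
  finally show ?thesis .
qed

lemma card_exceptional_le:
  fixes x :: real
  assumes "simple_graph G" "0 < x" "2 * card (edges (missing_graph G p)) \<le> x\<^sup>2 / 8"
  shows "card (exceptional G p x) \<le> x / 8"
proof -
  have "card (exceptional G p x) * x \<le> (x / 8) * x"
    using card_exceptional_mult_le[OF assms(1), of p x] assms(3) by (simp add: power2_eq_square)
  then show ?thesis using assms(2) by (simp only: mult_le_cancel_right_pos)
qed

context colour_critical
begin

context
  fixes a t :: nat and G :: "'b graph" and p :: "'b \<Rightarrow> nat"
  assumes k: "k \<ge> 2" and t: "card (verts H) \<le> t" "a \<le> t"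
    and myc: "is_subgraph H (blown_up_mycielskian k a a 1)"
    and G: "simple_graph G" and free: "free_of H G" and p: "\<And>v. p v < k"
    and opt: "\<And>v i. i < k \<Longrightarrow> degree (inner_graph G p) v \<le> card (colour_class (neighbours G v) p i)"
    and large: "8 * t \<le> missing_ratio k t * card (verts G)"
      "4 * k * (real (k * t) + t + 1) \<le> card (verts G)"
begin

lemma t_pos: "t > 0"
  using card_verts_pos t(1) by simp

lemma card_inner_edges_le_exceptional:
  fixes B and n :: real
  defines "n \<equiv> card (verts G)"
  defines "B \<equiv> exceptional G p (missing_ratio k t * n)"
  assumes dev: "(\<Sum>i<k. (real (card (colour_class (verts G) p i)) - n / k)\<^sup>2) \<le> (missing_ratio k t * n)\<^sup>2 / 8"
    and small: "card B \<le> missing_ratio k t * n / 8"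
  shows "card (edges (inner_graph G p)) \<le> card B * (card B + t)"
proof (rule card_inner_edges_le[OF G free p t(1) _ _ _ _ myc t(2) k opt])
  have ratio: "0 < missing_ratio k t" "missing_ratio k t \<le> 1 / k"
    using missing_ratio_pos missing_ratio_le k_pos t_pos by auto
  then have scaled: "0 \<le> missing_ratio k t * n" "missing_ratio k t * n \<le> n / k"
    using mult_right_mono[OF ratio(2), of n] by (simp_all add: n_def)
  show "B \<subseteq> verts G" "\<And>v. v \<in> verts G - B \<Longrightarrow> degree (missing_graph G p) v \<le> missing_ratio k t * n"
    "0 \<le> missing_ratio k t * n"
    using scaled(1) by (auto simp: B_def exceptional_def)
  fix i assume "i < k"
  have "(missing_ratio k t * n)\<^sup>2 \<le> (n / k)\<^sup>2"
    using scaled by (intro power_mono) auto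
  then have "(missing_ratio k t * n)\<^sup>2 / 8 \<le> (n / k)\<^sup>2 / 4"
    using zero_le_power2[of "n / k"] by linarith
  then have "(missing_ratio k t * n)\<^sup>2 / 8 \<le> (n / (2 * k))\<^sup>2"
    by (simp add: power_mult_distrib power_divide)
  then have "n / (2 * k) \<le> card (colour_class (verts G) p i)"
    using dev \<open>i < k\<close>
    by (intro ge_half_average_if_deviation_le[where q = "\<lambda>i. real (card (colour_class (verts G) p i))"])
      (auto simp: n_def)
  moreover have "card B \<le> n / (8 * k)"
    using small scaled(2) by (simp add: field_simps)
  ultimately show "(k * t + k * t) * (missing_ratio k t * n) + card B + k * t + 1 + t
      \<le> card (colour_class (verts G) p i)"
    using large(2) by (intro greedy_room k_pos t_pos) (auto simp: n_def)
qed

lemma card_inner_edges_bound: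
  fixes f n :: real
  defines "n \<equiv> card (verts G)"
  assumes few: "card (edges (inner_graph G p)) \<le> (missing_ratio k t * n)\<^sup>2 / 32"
    and dense: "(1 - 1 / k) * n\<^sup>2 - (2 * f + k) \<le> 2 * card (edges G)"
    and f: "2 * f + k \<le> (missing_ratio k t * n)\<^sup>2 / 16"
    and ratio: "4 * k \<le> missing_ratio k t * n"
  shows "card (edges (inner_graph G p)) \<le> 64 * (real t + 1) * f\<^sup>2 / (missing_ratio k t * n)\<^sup>2"
proof -
  define B where "B = exceptional G p (missing_ratio k t * n)"
  define I M where "I = card (edges (inner_graph G p))" and "M = card (edges (missing_graph G p))"
  define dev where "dev = (\<Sum>i<k. (real (card (colour_class (verts G) p i)) - n / k)\<^sup>2)"
  have pos: "0 < missing_ratio k t * n" using large(1) t_pos by (simp add: n_def)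
  have "dev + 2 * M = (1 - 1 / k) * n\<^sup>2 - 2 * card (edges G) + 2 * I"
    using sum_square_deviation_add_missing[OF G k_pos p] by (simp add: dev_def n_def M_def I_def)
  moreover have "0 \<le> dev" by (simp add: dev_def sum_nonneg)
  ultimately have missing: "2 * real M \<le> 2 * f + k + 2 * I" and "2 * real M \<le> (missing_ratio k t * n)\<^sup>2 / 8"
    and "dev \<le> (missing_ratio k t * n)\<^sup>2 / 8"
    using dense f few by (simp_all add: I_def)
  have B: "card B * (missing_ratio k t * n) \<le> 2 * real M" "card B \<le> missing_ratio k t * n / 8"
    using card_exceptional_mult_le[OF G, of p "missing_ratio k t * n"] card_exceptional_le[OF G pos, of p]
      \<open>2 * real M \<le> (missing_ratio k t * n)\<^sup>2 / 8\<close> by (simp_all add: B_def M_def)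
  have "I \<le> card B * (card B + t)"
    using card_inner_edges_le_exceptional \<open>dev \<le> _\<close> B(2) by (simp add: I_def B_def dev_def n_def)
  then have "real I \<le> card B * (real (card B) + t)"
    by (simp flip: of_nat_add of_nat_mult)
  then have "real I \<le> 64 * (real t + 1) * f\<^sup>2 / (missing_ratio k t * n)\<^sup>2"
    using pos B missing large(1) ratio
    by (intro inner_edge_count_bound[where b = "card B" and K = k]) (auto simp: n_def)
  then show ?thesis by (simp add: I_def)
qed

end

lemma almost_k_partite_if_dense:
  fixes f n :: real and G :: "'b graph"
  defines "n \<equiv> card (verts G)"
  assumes "k \<ge> 2" "card (verts H) \<le> t" "a \<le> t" "is_subgraph H (blown_up_mycielskian k a a 1)"
    and G: "simple_graph G" "free_of H G"
    and few: "almost_k_partite k G ((missing_ratio k t * n)\<^sup>2 / 32)"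
    and dense: "(1 - 1 / k) * n\<^sup>2 - (2 * f + k) \<le> 2 * card (edges G)"
    and f: "2 * f + k \<le> (missing_ratio k t * n)\<^sup>2 / 16"
    and large: "8 * t \<le> missing_ratio k t * n" "4 * k * (real (k * t) + t + 1) \<le> n"
      "4 * k \<le> missing_ratio k t * n"
  shows "almost_k_partite k G (64 * (real t + 1) * f\<^sup>2 / (missing_ratio k t * n)\<^sup>2)"
proof -
  obtain p where p: "\<And>v. p v < k" "card (edges (inner_graph G p)) \<le> (missing_ratio k t * n)\<^sup>2 / 32"
    "\<And>v i. i < k \<Longrightarrow> degree (inner_graph G p) v \<le> card (colour_class (neighbours G v) p i)"
    using almost_k_partite_locally_optimal[OF G(1) few] by blast
  then have "card (edges (inner_graph G p)) \<le> 64 * (real t + 1) * f\<^sup>2 / (missing_ratio k t * n)\<^sup>2"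
    using card_inner_edges_bound[OF assms(2-5) G p(1,3)] dense f large by (simp add: n_def)
  then show ?thesis using p(1) by (auto simp: almost_k_partite_def)
qed

lemma eventually_refined_if_stable:
  fixes \<delta> \<eta> :: real and a t :: nat
  defines "\<gamma> \<equiv> missing_ratio k t"
  assumes params: "k \<ge> 2" "card (verts H) \<le> t" "a \<le> t" "is_subgraph H (blown_up_mycielskian k a a 1)"
    and stable: "\<forall>\<^sub>F G :: 'b graph in large_graphs. free_of H G \<longrightarrow>
      (1 - 1 / k - \<delta>) * real (card (verts G)) ^ 2 \<le> 2 * card (edges G) \<longrightarrow>
      almost_k_partite k G (\<gamma>\<^sup>2 / 32 * real (card (verts G)) ^ 2)"
    and \<eta>: "0 < \<eta>" "\<eta> \<le> \<delta>" "\<eta> \<le> \<gamma>\<^sup>2 / 16"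
  shows "\<forall>\<^sub>F G :: 'b graph in large_graphs. \<forall>f. free_of H G \<longrightarrow> f \<le> \<eta> / 4 * real (card (verts G)) ^ 2 \<longrightarrow>
    real (turan_number k (card (verts G))) - f \<le> card (edges G) \<longrightarrow>
    almost_k_partite k G (64 * (real t + 1) / \<gamma>\<^sup>2 * f\<^sup>2 / real (card (verts G)) ^ 2)"
proof -
  have \<gamma>: "\<gamma> > 0" using card_verts_pos params(2) by (simp add: \<gamma>_def missing_ratio_pos k_pos)
  show ?thesis
    using stable eventually_simple_graph eventually_le_mult_card_verts[OF \<gamma>, of "8 * t"]
      eventually_le_mult_card_verts[OF \<gamma>, of "4 * k"]
      eventually_le_mult_card_verts[OF zero_less_one, of "4 * k * (real (k * t) + t + 1)"]
      eventually_le_mult_card_verts_square[OF half_gt_zero[OF \<eta>(1)], of k]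
  proof eventually_elim
    case (elim G)
    define n where "n = real (card (verts G))"
    show ?case
    proof (intro allI impI)
      fix f
      assume free: "free_of H G" and f: "f \<le> \<eta> / 4 * (real (card (verts G)))\<^sup>2"
        and "real (turan_number k (card (verts G))) - f \<le> card (edges G)"
      then have dense: "(1 - 1 / k) * n\<^sup>2 - (2 * f + k) \<le> 2 * card (edges G)"
        using dense_if_almost_extremal[OF k_pos, of "card (verts G)" f "card (edges G)"]
        by (simp add: n_def)
      have "2 * f + k \<le> \<eta> * n\<^sup>2" using f elim(6) by (simp add: n_def)
      moreover have "\<eta> * n\<^sup>2 \<le> \<delta> * n\<^sup>2" "\<eta> * n\<^sup>2 \<le> \<gamma>\<^sup>2 / 16 * n\<^sup>2"
        using \<eta>(2,3) by (intro mult_right_mono; simp)+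
      ultimately have small: "2 * f + k \<le> \<delta> * n\<^sup>2" "2 * f + k \<le> (\<gamma> * n)\<^sup>2 / 16"
        by (simp_all add: power_mult_distrib)
      have "(1 - 1 / k - \<delta>) * n\<^sup>2 \<le> 2 * card (edges G)"
        using dense small(1) by (simp add: algebra_simps)
      then have "almost_k_partite k G ((\<gamma> * n)\<^sup>2 / 32)"
        using elim(1) free by (simp add: n_def power_mult_distrib)
      then have "almost_k_partite k G (64 * (real t + 1) * f\<^sup>2 / (\<gamma> * n)\<^sup>2)"
        using elim small(2) dense unfolding n_def \<gamma>_def
        by (intro almost_k_partite_if_dense[OF params elim(2) free]) auto
      then show "almost_k_partite k G (64 * (real t + 1) / \<gamma>\<^sup>2 * f\<^sup>2 / (real (card (verts G)))\<^sup>2)"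
        by (simp add: power_mult_distrib n_def)
    qed
  qed
qed

theorem eventually_almost_k_partite_if_almost_extremal:
  assumes k: "k \<ge> 2" and myc: "is_subgraph H (blown_up_mycielskian k a a 1)"
  obtains C \<eta> :: real where "\<eta> > 0"
    "\<forall>\<^sub>F G :: 'b graph in large_graphs. \<forall>f. free_of H G \<longrightarrow> f \<le> \<eta> * real (card (verts G)) ^ 2 \<longrightarrow>
      real (turan_number k (card (verts G))) - f \<le> card (edges G) \<longrightarrow>
      almost_k_partite k G (C * f\<^sup>2 / real (card (verts G)) ^ 2)"
proof -
  define t where "t = max (card (verts H)) a"
  have t: "card (verts H) \<le> t" "a \<le> t" by (auto simp: t_def)
  have "missing_ratio k t > 0" using card_verts_pos t(1) by (simp add: missing_ratio_pos k_pos)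
  then have pos: "(missing_ratio k t)\<^sup>2 / 32 > 0" by simp
  obtain \<delta> where "\<delta> > 0" and stable: "\<forall>\<^sub>F G :: 'b graph in large_graphs. free_of H G \<longrightarrow>
      (1 - 1 / k - \<delta>) * real (card (verts G)) ^ 2 \<le> 2 * card (edges G) \<longrightarrow>
      almost_k_partite k G ((missing_ratio k t)\<^sup>2 / 32 * real (card (verts G)) ^ 2)"
    by (rule stability[OF k pos])
  define \<eta> where "\<eta> = min \<delta> ((missing_ratio k t)\<^sup>2 / 16)"
  have \<eta>: "0 < \<eta>" "\<eta> \<le> \<delta>" "\<eta> \<le> (missing_ratio k t)\<^sup>2 / 16"
    using \<open>\<delta> > 0\<close> pos by (auto simp: \<eta>_def)
  then have "0 < \<eta> / 4" by simp
  then show thesis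
    using eventually_refined_if_stable[OF k t myc stable \<eta>] by (rule that)
qed

end

theorem theorem7:
  fixes H :: "'a graph" and k a :: nat and f :: "nat \<Rightarrow> real"
  assumes "simple_graph H"
    and "\<exists>e. critical_edge H e"
    and "chromatic_number H = k + 1"
    and "k + 1 \<ge> 3"
    and "a > 0"
    and "is_subgraph H (blown_up_mycielskian k a a 1)"
    and "\<And>n. f n \<ge> 0"
    and "f \<in> o(\<lambda>n. real n ^ 2)"
  shows "\<exists>C :: real. \<forall>\<^sub>F n in sequentially. \<forall>G :: 'b graph.
           simple_graph G \<and> card (verts G) = n \<and> free_of H G \<and>
           real (card (edges G)) \<ge> real (turan_number k n) - f n \<longrightarrow>
           (\<exists>F. F \<subseteq> edges G \<and> real (card F) \<le> C * f n ^ 2 / real n ^ 2 \<and>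
                k_partite k (delete_edges G F))"
proof -
  interpret colour_critical H k
    by (rule colour_critical.intro[OF assms(1-3)])
  have k: "k \<ge> 2" using assms(4) by simp
  obtain C \<eta> where "\<eta> > 0" and stable: "\<forall>\<^sub>F G :: 'b graph in large_graphs. \<forall>f. free_of H G \<longrightarrow>
      f \<le> \<eta> * real (card (verts G)) ^ 2 \<longrightarrow>
      real (turan_number k (card (verts G))) - f \<le> card (edges G) \<longrightarrow>
      almost_k_partite k G (C * f\<^sup>2 / real (card (verts G)) ^ 2)"
    by (rule eventually_almost_k_partite_if_almost_extremal[OF k assms(6)])
  have "\<forall>\<^sub>F n in sequentially. f n \<le> \<eta> * real n ^ 2"
    using landau_o.smallD[OF assms(8) \<open>\<eta> > 0\<close>] assms(7) by simp
  with eventually_large_graphsD[OF stable] show ?thesis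
  proof (intro exI[of _ C], eventually_elim)
    case (elim n)
    have "almost_k_partite k G (C * f n ^ 2 / real n ^ 2)"
      if "simple_graph G" "card (verts G) = n" "free_of H G"
        "real (turan_number k n) - f n \<le> card (edges G)" for G :: "'b graph"
      using elim that by blast
    then show ?case using almost_k_partiteD by blast
  qed
qed

end
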